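(* There is a constant $C>0$, independent of $\lambda\in(0,1]$, of the grid size $m_1$, of $L$ and of the realization $n$, such that the following holds. Let $A^{(n)}=\lambda A_\Delta+(1-\lambda)A_s^{(n)}\in\mathbb{R}^{m_1^2\times m_1^2}$ be the stiffness matrix of the two-dimensional periodic stochastic elliptic problem with coefficient equal to $1$ on the covered domain $\widehat G_n$ and $\lambda$ elsewhere, and let $B=\frac{1+\lambda}{2}A_\Delta$ be the preconditioner (with regularization parameter $\delta=0$). Then the condition number of the preconditioned matrix satisfies $$\mathrm{cond}\{B^{-1}A^{(n)}\}\le C\lambda^{-1}.$$
   Context: Setting: $\Omega=[0,1)^2$ with periodic boundary conditions and a uniform $m_1\times m_1$ grid. For $L\in\mathbb{N}$ and $\alpha\in(0,1/2]$, a realization (numbered by $n$) consists of $L^2$ possibly overlapping axi-parallel square cells $G_s$ of size $\frac{2\alpha}{L}\times\frac{2\alpha}{L}$ aligned with the grid (taken periodically), and $\widehat G_n=\bigcup_{s=1}^{L^2}G_s$. The coefficient is $a^{(n)}(x)=\lambda+(1-\lambda)\widehat a^{(n)}(x)$, where $\widehat a^{(n)}$ is the indicator function of $\widehat G_n$. Matrices: $\otimes$ is the Kronecker product, $I_{m_1}$ the identity matrix of size $m_1$. Let $P^{(1)}\in\mathbb{R}^{m_1\times m_1}$ have all entries zero except $P^{(1)}_{1,m_1}=P^{(1)}_{m_1,1}=1$ and $P^{(1)}_{1,1}=P^{(1)}_{m_1,m_1}=-1$. For $m\ge2$ let $\widehat Q_m=\mathrm{tridiag}\{1,-2,1\}+\mathrm{diag}\{1,0,\dots,0,1\}\in\mathbb{R}^{m\times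 m}$ (the one-dimensional Neumann discrete Laplacian, with diagonal $-1,-2,\dots,-2,-1$) and $\widehat I_m=\mathrm{diag}\{1/2,1,\dots,1,1/2\}\in\mathbb{R}^{m\times m}$. The periodic discrete Laplacian is $$A_\Delta=\Delta_1\otimes I_{m_1}+I_{m_1}\otimes\Delta_1,\qquad -\Delta_1=\widehat Q_{m_1}+P^{(1)},$$ so that $A_\Delta$ is symmetric positive semidefinite with kernel spanned by the constant vector. The set $\widehat G_n$ is decomposed as $\widehat G_n=\bigcup_{k=1}^K S_k$ into $K\ge L^2$ non-overlapping elementary square cells $S_k$ of grid-size $\overline m_0\times\overline m_0$, $\overline m_0\geq 2$, different cells having at most boundary in common; $S_k$ is supported on the index set $I_k^{(1)}\times I_k^{(2)}$, where each $I_k^{(\ell)}\subset\{1,\dots,m_1\}$ consists of $\overline m_0$ consecutive indices. For $\ell=1,2$ let $\overline Q_k^{(\ell)},\overline I_k^{(\ell)}\in\mathbb{R}^{m_1\times m_1}$ be obtained by inserting $\widehat Q_{\overline m_0}$, respectively $\widehat I_{\overline m_0}$, as a diagonal block in the positions $I_k^{(\ell)}\times I_k^{(\ell)}$ of the zero matrix. Then $$A_s^{(n)}=-\Big(\sum_{k=1}^K\big(\overline Q_k^{(1)}\otimes\overline I_k^{(2)}+\overline I_k^{(1)}\otimes\overline Q_k^{(2)}\big)+P^{(1)}\otimes I_{m_1}+I_{m_1}\otimes P^{(1)}\Big).$$ Both $A^{(n)}$ and $B$ are symmetric, positive semidefinite and vanish on constant vectors; $B^{-1}A^{(n)}$ and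 its condition number (ratio of largest to smallest eigenvalue) are understood on the space of vectors orthogonal to the constant vector. *)

theory Defs
  imports Complex_Main "HOL-Library.Disjoint_Sets" "Jordan_Normal_Form.Matrix"
begin

text \<open>Matrix and grid indices start at 0: grid index \<open>i\<close> here is index \<open>i + 1\<close> in the
  usual numbering \<open>1, \<dots>, m1\<close>.\<close>

section \<open>Covered domain\<close>

definition Omega :: "(real \<times> real) set" where
  "Omega = {0..<1} \<times> {0..<1}"

text \<open>The square of side length \<open>l\<close> with lower left corner \<open>p\<close>, wrapped periodically into
  \<open>Omega\<close>. All cells are taken half-open, as \<open>Omega\<close> itself is, so that different cells
  with at most boundary in common are exactly disjoint ones.\<close>

definition periodic_cell :: "real \<Rightarrow> real \<times> real \<Rightarrow> (real \<times> real) set" where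
  "periodic_cell l p = {x \<in> Omega. frac (fst x - fst p) < l \<and> frac (snd x - snd p) < l}"

text \<open>A realization: the union of \<open>L\<^sup>2\<close> cells of side length \<open>2 * \<alpha> / L\<close> whose edges lie
  on lines of the grid of mesh width \<open>h\<close>. The cells may overlap.\<close>

definition is_realization :: "real \<Rightarrow> nat \<Rightarrow> real \<Rightarrow> (real \<times> real) set \<Rightarrow> bool" where
  "is_realization h L \<alpha> G \<longleftrightarrow>
     (\<exists>c :: nat. 2 * \<alpha> / real L = real c * h) \<and>
     (\<exists>p q :: nat \<Rightarrow> nat.
        G = (\<Union>s<L\<^sup>2. periodic_cell (2 * \<alpha> / real L) (real (p s) * h, real (q s) * h)))"

text \<open>The mesh width of an \<open>m1 \<times> m1\<close> grid is \<open>1 / m1\<close> if node \<open>m1\<close> is the last one before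
  the periodic image of node \<open>0\<close>, and \<open>1 / (m1 - 1)\<close> if nodes are placed on both ends of the
  unit interval. Both conventions are admitted; the matrices do not depend on the choice.\<close>

definition is_mesh_width :: "nat \<Rightarrow> real \<Rightarrow> bool" where
  "is_mesh_width m1 h \<longleftrightarrow> h = 1 / real m1 \<or> h = 1 / (real m1 - 1)"

text \<open>An elementary cell carries \<open>m0 \<times> m0\<close> nodes, with index set
  \<open>{i..<i+m0} \<times> {j..<j+m0}\<close>; hence its side length is \<open>(m0 - 1) * h\<close>.\<close>

definition elementary_cell :: "real \<Rightarrow> nat \<Rightarrow> nat \<Rightarrow> nat \<Rightarrow> (real \<times> real) set" where
  "elementary_cell h m0 i j =
     {real i * h ..< real (i + m0 - 1) * h} \<times> {real j * h ..< real (j + m0 - 1) * h}"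

text \<open>Cell number \<open>k < K\<close> of the decomposition is given by the first indices \<open>i1 k\<close> and
  \<open>i2 k\<close> of its two one-dimensional index sets.\<close>

definition is_decomposition ::
    "nat \<Rightarrow> real \<Rightarrow> nat \<Rightarrow> nat \<Rightarrow> (nat \<Rightarrow> nat) \<Rightarrow> (nat \<Rightarrow> nat) \<Rightarrow> (real \<times> real) set \<Rightarrow> bool" where
  "is_decomposition m1 h m0 K i1 i2 G \<longleftrightarrow>
     2 \<le> m0 \<and>
     (\<forall>k<K. i1 k + m0 \<le> m1 \<and> i2 k + m0 \<le> m1) \<and>
     disjoint_family_on (\<lambda>k. elementary_cell h m0 (i1 k) (i2 k)) {..<K} \<and>
     G = (\<Union>k<K. elementary_cell h m0 (i1 k) (i2 k))"

section \<open>Matrices\<close>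

definition kronecker :: "real mat \<Rightarrow> real mat \<Rightarrow> real mat" (infixl "\<otimes>\<^sub>K" 70) where
  "A \<otimes>\<^sub>K B = mat (dim_row A * dim_row B) (dim_col A * dim_col B)
     (\<lambda>(i, j). A $$ (i div dim_row B, j div dim_col B) * B $$ (i mod dim_row B, j mod dim_col B))"

definition tridiag :: "nat \<Rightarrow> real \<Rightarrow> real \<Rightarrow> real \<Rightarrow> real mat" where
  "tridiag m a b c =
     mat m m (\<lambda>(i, j). if i = j + 1 then a else if i = j then b else if j = i + 1 then c else 0)"

definition neumann_Q :: "nat \<Rightarrow> real mat" where
  "neumann_Q m = tridiag m 1 (-2) 1 + mat_diag m (\<lambda>i. if i = 0 \<or> i = m - 1 then 1 else 0)"

definition neumann_I :: "nat \<Rightarrow> real mat" where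
  "neumann_I m = mat_diag m (\<lambda>i. if i = 0 \<or> i = m - 1 then 1 / 2 else 1)"

definition periodic_P :: "nat \<Rightarrow> real mat" where
  "periodic_P m = mat m m (\<lambda>(i, j).
     if i \<in> {0, m - 1} \<and> j \<in> {0, m - 1} then (if i = j then -1 else 1) else 0)"

definition insert_block :: "nat \<Rightarrow> nat \<Rightarrow> real mat \<Rightarrow> real mat" where
  "insert_block m i0 M = mat m m (\<lambda>(r, c).
     if r \<in> {i0..<i0 + dim_row M} \<and> c \<in> {i0..<i0 + dim_col M} then M $$ (r - i0, c - i0) else 0)"

definition Delta1 :: "nat \<Rightarrow> real mat" where
  "Delta1 m1 = - (neumann_Q m1 + periodic_P m1)"

definition A_Delta :: "nat \<Rightarrow> real mat" where
  "A_Delta m1 = Delta1 m1 \<otimes>\<^sub>K 1\<^sub>m m1 + 1\<^sub>m m1 \<otimes>\<^sub>K Delta1 m1"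

definition cell_mat :: "nat \<Rightarrow> nat \<Rightarrow> nat \<Rightarrow> nat \<Rightarrow> real mat" where
  "cell_mat m1 m0 i j =
     insert_block m1 i (neumann_Q m0) \<otimes>\<^sub>K insert_block m1 j (neumann_I m0)
     + insert_block m1 i (neumann_I m0) \<otimes>\<^sub>K insert_block m1 j (neumann_Q m0)"

definition A_s :: "nat \<Rightarrow> nat \<Rightarrow> nat \<Rightarrow> (nat \<Rightarrow> nat) \<Rightarrow> (nat \<Rightarrow> nat) \<Rightarrow> real mat" where
  "A_s m1 m0 K i1 i2 =
     - (mat (m1 * m1) (m1 * m1) (\<lambda>(r, c). \<Sum>k<K. cell_mat m1 m0 (i1 k) (i2 k) $$ (r, c))
        + periodic_P m1 \<otimes>\<^sub>K 1\<^sub>m m1 + 1\<^sub>m m1 \<otimes>\<^sub>K periodic_P m1)"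

definition stiffness ::
    "real \<Rightarrow> nat \<Rightarrow> nat \<Rightarrow> nat \<Rightarrow> (nat \<Rightarrow> nat) \<Rightarrow> (nat \<Rightarrow> nat) \<Rightarrow> real mat" where
  "stiffness lam m1 m0 K i1 i2 = lam \<cdot>\<^sub>m A_Delta m1 + (1 - lam) \<cdot>\<^sub>m A_s m1 m0 K i1 i2"

definition preconditioner :: "real \<Rightarrow> nat \<Rightarrow> real mat" where
  "preconditioner lam m1 = ((1 + lam) / 2) \<cdot>\<^sub>m A_Delta m1"

section \<open>Condition number on the orthogonal complement of the constants\<close>

definition mean_zero :: "nat \<Rightarrow> real vec set" where
  "mean_zero n = {v \<in> carrier_vec n. v \<bullet> vec n (\<lambda>_. 1) = 0}"

text \<open>\<open>B\<inverse> A\<close> as an operator on \<open>mean_zero n\<close>, where \<open>B\<close> is invertible although it is singular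
  on the whole space.\<close>

definition precond_op :: "real mat \<Rightarrow> real mat \<Rightarrow> real vec \<Rightarrow> real vec" where
  "precond_op B A v = inv_into (mean_zero (dim_col B)) (\<lambda>w. B *\<^sub>v w) (A *\<^sub>v v)"

definition precond_eigenvalues :: "real mat \<Rightarrow> real mat \<Rightarrow> real set" where
  "precond_eigenvalues B A =
     {\<mu>. \<exists>v \<in> mean_zero (dim_col B). v \<noteq> 0\<^sub>v (dim_col B) \<and> precond_op B A v = \<mu> \<cdot>\<^sub>v v}"

definition precond_cond :: "real mat \<Rightarrow> real mat \<Rightarrow> real" where
  "precond_cond B A = Max (precond_eigenvalues B A) / Min (precond_eigenvalues B A)"

end

theory Submission
  imports Defs "Jordan_Normal_Form.Spectral_Radius"
begin

text \<open>Two obstacles shape the proof. The preconditioner is singular, and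
  \<open>precond_op\<close> inverts it through \<open>inv_into\<close>; so it must be shown to
  permute the mean-zero vectors, and the image of \<open>A\<close> must lie among them, before
  eigenvalues become solutions of \<open>A v = \<mu> B v\<close>. Moreover the inverse of
  \<open>B\<close> times \<open>A\<close> is in general not a symmetric matrix, so a real eigenvalue
  is obtained through a complex one and the symmetry of the two forms. Matrix entries are touched
  only in one dimension. There each factor is a weighted sum of rank-one matrices built from edge
  vectors \<open>dif\<close> or unit vectors \<open>ind\<close>, and a Kronecker product of such
  sums again has this shape. This yields bilinear forms in explicit differences, from which
  symmetry, kernel and both bounds are read off. The periodic edges occur with full weight in
  \<open>A_s\<close> as well as in \<open>A_Delta\<close>, so only the interior edges have to be
  compared. The factor \<open>(1 + lam) / 2\<close> of the preconditioner is common to both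
  eigenvalue bounds and cancels in their quotient \<open>1 / lam\<close>.\<close>

text \<open>The form of \<open>A_s\<close> is a sum of energies of mesh squares, each giving weight 1/2 to its four
  edges, plus the periodic edges. The cells are disjoint and an edge borders at most two mesh squares,
  so \<open>0 \<le> A_s \<le> A_Delta\<close> as quadratic forms and \<open>lam * A_Delta \<le> A \<le> A_Delta\<close>. Hence the
  eigenvalues of the preconditioned matrix lie in \<open>[2 * lam / (1 + lam), 2 / (1 + lam)]\<close>, and
  \<open>C = 1\<close> works. That \<open>Max\<close> and \<open>Min\<close> are taken over a finite nonempty set is seen by deleting the
  last row and column, which turns the singular pencil on mean-zero vectors into a regular one.\<close>

section \<open>Singular symmetric pencils\<close>

abbreviation ones :: "nat \<Rightarrow> real vec" where
  "ones n \<equiv> vec n (\<lambda>_. 1)"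

text \<open>Symmetry is phrased through the bilinear form rather than by transposition, because the
  form is what gets computed for the matrices at hand.\<close>

definition sym_null_const :: "nat \<Rightarrow> real mat \<Rightarrow> bool" where
  "sym_null_const n M \<longleftrightarrow> M \<in> carrier_mat n n \<and>
     (\<forall>u\<in>carrier_vec n. \<forall>v\<in>carrier_vec n. u \<bullet> (M *\<^sub>v v) = v \<bullet> (M *\<^sub>v u)) \<and>
     M *\<^sub>v ones n = 0\<^sub>v n"

text \<open>For a graph Laplacian this is the grounded Laplacian: the potential of the last node is
  fixed at 0, and \<open>ext0\<close> puts that node back.\<close>

definition ground :: "real mat \<Rightarrow> real mat" where
  "ground M = mat (dim_row M - 1) (dim_col M - 1) (\<lambda>(i, j). M $$ (i, j))"

definition ext0 :: "real vec \<Rightarrow> real vec" where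
  "ext0 w = vec (Suc (dim_vec w)) (\<lambda>i. if i < dim_vec w then w $ i else 0)"

lemma ext0_carrier [simp]: "w \<in> carrier_vec m \<Longrightarrow> ext0 w \<in> carrier_vec (Suc m)"
  by (auto simp: ext0_def)

lemma ground_carrier: "M \<in> carrier_mat (Suc m) (Suc m) \<Longrightarrow> ground M \<in> carrier_mat m m"
  by (auto simp: ground_def)

text \<open>Symmetry moves \<open>M\<close> from \<open>v\<close> to the constant vector, where it
  vanishes.\<close>

lemma sym_null_const_mult_mean_zero:
  assumes "sym_null_const n M" "v \<in> carrier_vec n"
  shows "M *\<^sub>v v \<in> mean_zero n"
proof -
  have "v \<bullet> (M *\<^sub>v ones n) = ones n \<bullet> (M *\<^sub>v v)"
    using assms by (simp add: sym_null_const_def)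
  moreover have "v \<bullet> (M *\<^sub>v ones n) = 0"
    using assms by (simp add: sym_null_const_def)
  ultimately show ?thesis
    using assms by (auto simp: mean_zero_def sym_null_const_def comm_scalar_prod[of _ n "ones n"])
qed

text \<open>Allows a change of representative modulo constants, between the mean-zero vector and the
  one that is 0 at the last node.\<close>

lemma sym_null_const_shift:
  assumes M: "sym_null_const n M" and v: "v \<in> carrier_vec n"
  shows "M *\<^sub>v (v + c \<cdot>\<^sub>v ones n) = M *\<^sub>v v"
    and "(v + c \<cdot>\<^sub>v ones n) \<bullet> (M *\<^sub>v (v + c \<cdot>\<^sub>v ones n)) = v \<bullet> (M *\<^sub>v v)"
proof -
  have c: "M \<in> carrier_mat n n" and n: "M *\<^sub>v ones n = 0\<^sub>v n"
    using M by (auto simp: sym_null_const_def)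
  show 1: "M *\<^sub>v (v + c \<cdot>\<^sub>v ones n) = M *\<^sub>v v"
    using c v n by (auto simp: mult_add_distrib_mat_vec mult_mat_vec intro!: eq_vecI)
  have "M *\<^sub>v v \<in> mean_zero n"
    using M v by (rule sym_null_const_mult_mean_zero)
  then have "ones n \<bullet> (M *\<^sub>v v) = 0"
    using c v by (auto simp: mean_zero_def comm_scalar_prod[of _ n "ones n"])
  then show "(v + c \<cdot>\<^sub>v ones n) \<bullet> (M *\<^sub>v (v + c \<cdot>\<^sub>v ones n)) = v \<bullet> (M *\<^sub>v v)"
    unfolding 1 using c v by (subst add_scalar_prod_distrib[of _ n]) auto
qed

text \<open>The last entry is minus the sum of the others. Hence an equation between images of
  \<open>A\<close> and \<open>B\<close> need only be checked on the rows kept by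
  \<open>ground\<close>.\<close>

lemma mean_zero_eqI:
  assumes "y \<in> mean_zero (Suc m)" "z \<in> mean_zero (Suc m)" "\<And>i. i < m \<Longrightarrow> y $ i = z $ i"
  shows "y = z"
proof
  have "(\<Sum>i<Suc m. y $ i) = 0" "(\<Sum>i<Suc m. z $ i) = 0"
    using assms(1,2) by (auto simp: mean_zero_def scalar_prod_def lessThan_atLeast0)
  moreover have "(\<Sum>i<m. y $ i) = (\<Sum>i<m. z $ i)"
    using assms(3) by simp
  ultimately have "y $ m = z $ m" by simp
  then show "y $ i = z $ i" if "i < dim_vec z" for i
    using assms that by (cases "i = m") (auto simp: mean_zero_def)
qed (use assms in \<open>auto simp: mean_zero_def\<close>)

lemma mean_zero_smult: "v \<in> mean_zero n \<Longrightarrow> c \<cdot>\<^sub>v v \<in> mean_zero n"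
  by (auto simp: mean_zero_def)

lemma mean_zero_const:
  assumes "c \<cdot>\<^sub>v ones (Suc m) \<in> mean_zero (Suc m)"
  shows "c = 0"
proof -
  have "(1 + real m) * c = 0"
    using assms by (simp add: mean_zero_def scalar_prod_def algebra_simps)
  then show ?thesis by (simp add: add_nonneg_eq_0_iff)
qed

lemma mean_zero_shift:
  assumes "v \<in> carrier_vec (Suc m)"
  obtains c where "v + c \<cdot>\<^sub>v ones (Suc m) \<in> mean_zero (Suc m)"
proof
  show "v + (- (v \<bullet> ones (Suc m)) / real (Suc m)) \<cdot>\<^sub>v ones (Suc m) \<in> mean_zero (Suc m)"
    using assms unfolding mean_zero_def
    by (auto simp: add_scalar_prod_distrib[of _ "Suc m"] simp del: of_nat_Suc)
      (simp add: scalar_prod_def)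
qed

lemma mult_ext0_nth:
  assumes "M \<in> carrier_mat (Suc m) (Suc m)" "w \<in> carrier_vec m" "i < m"
  shows "(M *\<^sub>v ext0 w) $ i = (ground M *\<^sub>v w) $ i"
  using assms by (auto simp: scalar_prod_def ext0_def ground_def row_def)

text \<open>The zero entry of \<open>ext0 w\<close> removes the last column, that of
  \<open>ext0 w'\<close> the last row.\<close>

lemma ext0_scalar_prod:
  assumes "M \<in> carrier_mat (Suc m) (Suc m)" "w \<in> carrier_vec m" "w' \<in> carrier_vec m"
  shows "ext0 w' \<bullet> (M *\<^sub>v ext0 w) = w' \<bullet> (ground M *\<^sub>v w)"
proof -
  have "ext0 w' \<bullet> (M *\<^sub>v ext0 w) = (\<Sum>i<Suc m. ext0 w' $ i * (M *\<^sub>v ext0 w) $ i)"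
    using assms by (simp add: scalar_prod_def lessThan_atLeast0)
  also have "\<dots> = (\<Sum>i<m. w' $ i * (ground M *\<^sub>v w) $ i)"
    using assms mult_ext0_nth[OF assms(1,2)] by (auto simp: ext0_def simp del: index_mult_mat_vec)
  also have "\<dots> = w' \<bullet> (ground M *\<^sub>v w)"
    using ground_carrier[OF assms(1)] by (simp add: scalar_prod_def lessThan_atLeast0)
  finally show ?thesis .
qed

lemma ext0_decomp:
  assumes "v \<in> carrier_vec (Suc m)"
  obtains w c where "w \<in> carrier_vec m" "v = ext0 w + c \<cdot>\<^sub>v ones (Suc m)"
proof
  \<comment> \<open>The constant is the value at the last node, the only choice that leaves 0
    there.\<close>
  show "v = ext0 (vec m (\<lambda>i. v $ i - v $ m)) + (v $ m) \<cdot>\<^sub>v ones (Suc m)"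
    using assms by (intro eq_vecI) (auto simp: ext0_def less_Suc_eq)
qed auto

lemma ext0_const:
  assumes "ext0 w = c \<cdot>\<^sub>v ones (Suc (dim_vec w))"
  shows "c = 0" "w = 0\<^sub>v (dim_vec w)"
proof -
  have e: "ext0 w $ i = c" if "i \<le> dim_vec w" for i
    using that by (simp add: assms)
  show c: "c = 0"
    using e[of "dim_vec w"] by (simp add: ext0_def)
  show "w = 0\<^sub>v (dim_vec w)"
    proof (rule eq_vecI)
    fix i assume "i < dim_vec (0\<^sub>v (dim_vec w) :: real vec)"
    then show "w $ i = 0\<^sub>v (dim_vec w) $ i"
      using e[of i] c by (simp add: ext0_def)
  qed simp
qed

lemma ex_inverse_mat:
  fixes M :: "real mat"
  assumes M: "M \<in> carrier_mat m m" and inj: "\<And>w. w \<in> carrier_vec m \<Longrightarrow> M *\<^sub>v w = 0\<^sub>v m \<Longrightarrow> w = 0\<^sub>v m"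
  obtains N where "N \<in> carrier_mat m m" "M * N = 1\<^sub>m m" "N * M = 1\<^sub>m m"
proof -
  have "det M \<noteq> 0"
    using inj det_0_iff_vec_prod_zero[OF M] by blast
  from det_non_zero_imp_unit[OF M this, of "()"] that show thesis
    by (auto simp: Units_def ring_mat_def)
qed

text \<open>\<open>B_definite\<close> covers two facts at once: a vector with negative form would be
  constant and so have form 0, hence \<open>B\<close> is semidefinite, and its kernel consists of
  the constants. \<open>m_pos\<close> makes the mean-zero space nontrivial, without which there is
  no eigenvalue.\<close>

locale laplacian_pencil =
  fixes m :: nat and A B :: "real mat"
  assumes m_pos: "0 < m"
    and A: "sym_null_const (Suc m) A" and B: "sym_null_const (Suc m) B"
    and B_definite: "\<And>v. v \<in> carrier_vec (Suc m) \<Longrightarrow> v \<bullet> (B *\<^sub>v v) \<le> 0 \<Longrightarrow> \<exists>c. v = c \<cdot>\<^sub>v ones (Suc m)"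
begin

lemma carrier [simp]: "A \<in> carrier_mat (Suc m) (Suc m)" "B \<in> carrier_mat (Suc m) (Suc m)"
  using A B by (auto simp: sym_null_const_def)

lemma dim [simp]: "dim_row A = Suc m" "dim_col A = Suc m" "dim_row B = Suc m" "dim_col B = Suc m"
  using carrier by (auto simp del: carrier)

lemma ground_carrier' [simp]: "ground A \<in> carrier_mat m m" "ground B \<in> carrier_mat m m"
  by (simp_all add: ground_carrier)

lemma mult_carrier [simp]:
  "v \<in> carrier_vec (Suc m) \<Longrightarrow> A *\<^sub>v v \<in> carrier_vec (Suc m)"
  "v \<in> carrier_vec (Suc m) \<Longrightarrow> B *\<^sub>v v \<in> carrier_vec (Suc m)"
  "w \<in> carrier_vec m \<Longrightarrow> ground A *\<^sub>v w \<in> carrier_vec m"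
  "w \<in> carrier_vec m \<Longrightarrow> ground B *\<^sub>v w \<in> carrier_vec m"
  by (auto intro: mult_mat_vec_carrier carrier ground_carrier')

lemma ground_dim [simp]: "dim_row (ground A) = m" "dim_col (ground A) = m"
    "dim_row (ground B) = m" "dim_col (ground B) = m"
  by (simp_all add: ground_def)

lemma B_pos_mean_zero:
  assumes "v \<in> mean_zero (Suc m)" "v \<noteq> 0\<^sub>v (Suc m)"
  shows "0 < v \<bullet> (B *\<^sub>v v)"
proof (rule ccontr)
  assume "\<not> 0 < v \<bullet> (B *\<^sub>v v)"
  then obtain c where c: "v = c \<cdot>\<^sub>v ones (Suc m)"
    using B_definite[of v] assms by (auto simp: mean_zero_def)
  then have "c = 0"
    using mean_zero_const assms(1) by blast
  then show False
    using c assms(2) by auto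
qed

text \<open>Grounding makes the form definite, since \<open>ext0 w\<close> is 0 at the last node and
  so is constant only for zero \<open>w\<close>.\<close>

lemma ground_B_pos:
  assumes "w \<in> carrier_vec m" "w \<noteq> 0\<^sub>v m"
  shows "0 < w \<bullet> (ground B *\<^sub>v w)"
proof (rule ccontr)
  assume "\<not> 0 < w \<bullet> (ground B *\<^sub>v w)"
  then obtain c where "ext0 w = c \<cdot>\<^sub>v ones (Suc m)"
    using B_definite[of "ext0 w"] assms by (auto simp: ext0_scalar_prod[of B m w w])
  then show False
    using ext0_const[of w c] assms by auto
qed

lemma ex_ground_B_inverse:
  obtains N where "N \<in> carrier_mat m m" "ground B * N = 1\<^sub>m m" "N * ground B = 1\<^sub>m m"
proof (rule ex_inverse_mat[of "ground B" m])
  show "w = 0\<^sub>v m" if "w \<in> carrier_vec m" "ground B *\<^sub>v w = 0\<^sub>v m" for w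
    using ground_B_pos[of w] that by (cases "w = 0\<^sub>v m") auto
qed auto

text \<open>Makes \<open>inv_into\<close> in \<open>precond_op\<close> a true two-sided inverse on
  the mean-zero space.\<close>

lemma B_bij: "bij_betw (\<lambda>w. B *\<^sub>v w) (mean_zero (Suc m)) (mean_zero (Suc m))"
  unfolding bij_betw_def
proof
  show "inj_on (\<lambda>w. B *\<^sub>v w) (mean_zero (Suc m))"
  proof (rule inj_onI)
    fix v w assume vw: "v \<in> mean_zero (Suc m)" "w \<in> mean_zero (Suc m)" "B *\<^sub>v v = B *\<^sub>v w"
    then have c: "v \<in> carrier_vec (Suc m)" "w \<in> carrier_vec (Suc m)"
      by (auto simp: mean_zero_def)
    have "v - w \<in> mean_zero (Suc m)"
      using vw by (auto simp: mean_zero_def minus_scalar_prod_distrib[of _ "Suc m"])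
    moreover have "B *\<^sub>v (v - w) = 0\<^sub>v (Suc m)"
      using c vw(3) by (subst mult_minus_distrib_mat_vec[OF carrier(2)]) auto
    ultimately have "v - w = 0\<^sub>v (Suc m)"
      using B_pos_mean_zero[of "v - w"] c by (cases "v - w = 0\<^sub>v (Suc m)") auto
    show "v = w"
    proof (rule eq_vecI)
      fix i assume "i < dim_vec w"
      then show "v $ i = w $ i"
        using arg_cong[OF \<open>v - w = 0\<^sub>v (Suc m)\<close>, of "\<lambda>x. x $ i"] c by simp
    qed (use c in simp)
  qed
  show "(\<lambda>w. B *\<^sub>v w) ` mean_zero (Suc m) = mean_zero (Suc m)"
  proof (intro equalityI subsetI)
    fix x assume "x \<in> (\<lambda>w. B *\<^sub>v w) ` mean_zero (Suc m)"
    then show "x \<in> mean_zero (Suc m)"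
      using sym_null_const_mult_mean_zero[OF B] by (auto simp: mean_zero_def)
  next
    fix f assume f: "f \<in> mean_zero (Suc m)"
    \<comment> \<open>The grounded inverse solves the first \<open>m\<close> rows; the last row then
      holds because both sides have mean zero, and a constant shift makes the solution
      mean-zero.\<close>
    obtain N where N: "N \<in> carrier_mat m m" "ground B * N = 1\<^sub>m m"
      using ex_ground_B_inverse by metis
    define f' where "f' = vec m (\<lambda>i. f $ i)"
    have f': "f' \<in> carrier_vec m" by (simp add: f'_def)
    define w where "w = N *\<^sub>v f'"
    have w: "w \<in> carrier_vec m"
      using N(1) f' by (simp add: w_def mult_mat_vec_carrier)
    have "ground B *\<^sub>v w = f'"
      unfolding w_def using N f' by (simp flip: assoc_mult_mat_vec[of _ m m _ m])
    then have "B *\<^sub>v ext0 w = f"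
      using f w mult_ext0_nth[of B m w] sym_null_const_mult_mean_zero[OF B, of "ext0 w"]
      by (intro mean_zero_eqI[of _ m]) (auto simp: f'_def simp del: index_mult_mat_vec)
    moreover obtain c where "ext0 w + c \<cdot>\<^sub>v ones (Suc m) \<in> mean_zero (Suc m)"
      using mean_zero_shift[of "ext0 w" m] w by auto
    ultimately show "f \<in> (\<lambda>w. B *\<^sub>v w) ` mean_zero (Suc m)"
      using sym_null_const_shift(1)[OF B, of "ext0 w" c] w
      by (intro image_eqI[of _ _ "ext0 w + c \<cdot>\<^sub>v ones (Suc m)"]) auto
  qed
qed

text \<open>Replaces the operator with its inverse by a generalized eigenvalue problem;
  \<open>A *\<^sub>v v\<close> is mean-zero and hence in the range of \<open>B\<close>.\<close>

lemma precond_eigenvalues_eq: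
  "precond_eigenvalues B A =
     {\<mu>. \<exists>v\<in>mean_zero (Suc m). v \<noteq> 0\<^sub>v (Suc m) \<and> A *\<^sub>v v = \<mu> \<cdot>\<^sub>v (B *\<^sub>v v)}"
proof -
  have "precond_op B A v = \<mu> \<cdot>\<^sub>v v \<longleftrightarrow> A *\<^sub>v v = \<mu> \<cdot>\<^sub>v (B *\<^sub>v v)" if v: "v \<in> mean_zero (Suc m)" for v \<mu>
  proof -
    let ?S = "mean_zero (Suc m)" and ?f = "\<lambda>w. B *\<^sub>v w"
    have "v \<in> carrier_vec (Suc m)"
      using v by (simp add: mean_zero_def)
    then have Bv: "B *\<^sub>v (\<mu> \<cdot>\<^sub>v v) = \<mu> \<cdot>\<^sub>v (B *\<^sub>v v)" and Av: "A *\<^sub>v v \<in> ?S"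
      using mult_mat_vec[OF carrier(2)] sym_null_const_mult_mean_zero[OF A] by auto
    have "precond_op B A v = inv_into ?S ?f (A *\<^sub>v v)"
      using carrier(2) by (auto simp: precond_op_def)
    moreover have "?f (inv_into ?S ?f (A *\<^sub>v v)) = A *\<^sub>v v"
      using B_bij Av by (intro f_inv_into_f) (simp add: bij_betw_def)
    moreover have "inv_into ?S ?f (?f (\<mu> \<cdot>\<^sub>v v)) = \<mu> \<cdot>\<^sub>v v"
      using B_bij v by (intro inv_into_f_f) (auto simp: bij_betw_def mean_zero_smult)
    ultimately show ?thesis
      using Bv by metis
  qed
  then show ?thesis
    using carrier(2) unfolding precond_eigenvalues_def by auto
qed

lemma eigen_iff_ground:
  assumes "w \<in> carrier_vec m"
  shows "A *\<^sub>v ext0 w = \<mu> \<cdot>\<^sub>v (B *\<^sub>v ext0 w) \<longleftrightarrow> ground A *\<^sub>v w = \<mu> \<cdot>\<^sub>v (ground B *\<^sub>v w)"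
proof
  assume *: "A *\<^sub>v ext0 w = \<mu> \<cdot>\<^sub>v (B *\<^sub>v ext0 w)"
  show "ground A *\<^sub>v w = \<mu> \<cdot>\<^sub>v (ground B *\<^sub>v w)"
  proof (rule eq_vecI)
    fix i assume "i < dim_vec (\<mu> \<cdot>\<^sub>v (ground B *\<^sub>v w))"
    then have i: "i < m"
      using ground_carrier' by auto
    have "(A *\<^sub>v ext0 w) $ i = \<mu> * (B *\<^sub>v ext0 w) $ i"
      using * i carrier by (simp del: index_mult_mat_vec)
    then show "(ground A *\<^sub>v w) $ i = (\<mu> \<cdot>\<^sub>v (ground B *\<^sub>v w)) $ i"
      using i assms ground_carrier' by (simp add: mult_ext0_nth[of _ m] del: index_mult_mat_vec)
  qed (use ground_carrier' in auto)
next
  assume *: "ground A *\<^sub>v w = \<mu> \<cdot>\<^sub>v (ground B *\<^sub>v w)"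
  show "A *\<^sub>v ext0 w = \<mu> \<cdot>\<^sub>v (B *\<^sub>v ext0 w)"
  proof (rule mean_zero_eqI[of _ m])
    show "A *\<^sub>v ext0 w \<in> mean_zero (Suc m)" "\<mu> \<cdot>\<^sub>v (B *\<^sub>v ext0 w) \<in> mean_zero (Suc m)"
      using A B assms by (simp_all add: sym_null_const_mult_mean_zero mean_zero_smult)
    fix i assume i: "i < m"
    then have "(ground A *\<^sub>v w) $ i = \<mu> * (ground B *\<^sub>v w) $ i"
      using * ground_carrier' by (simp del: index_mult_mat_vec)
    then show "(A *\<^sub>v ext0 w) $ i = (\<mu> \<cdot>\<^sub>v (B *\<^sub>v ext0 w)) $ i"
      using i assms carrier by (simp add: mult_ext0_nth[of _ m] del: index_mult_mat_vec)
  qed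
qed

text \<open>Each class modulo constants has one mean-zero representative and one that is 0 at the
  last node, and the eigenvalue equation does not depend on the representative.\<close>

lemma precond_eigenvalues_eq_ground:
  "precond_eigenvalues B A =
     {\<mu>. \<exists>w\<in>carrier_vec m. w \<noteq> 0\<^sub>v m \<and> ground A *\<^sub>v w = \<mu> \<cdot>\<^sub>v (ground B *\<^sub>v w)}"
  unfolding precond_eigenvalues_eq
proof (rule Collect_cong)
  fix \<mu>
  show "(\<exists>v\<in>mean_zero (Suc m). v \<noteq> 0\<^sub>v (Suc m) \<and> A *\<^sub>v v = \<mu> \<cdot>\<^sub>v (B *\<^sub>v v)) \<longleftrightarrow>
        (\<exists>w\<in>carrier_vec m. w \<noteq> 0\<^sub>v m \<and> ground A *\<^sub>v w = \<mu> \<cdot>\<^sub>v (ground B *\<^sub>v w))"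
  proof
    assume "\<exists>v\<in>mean_zero (Suc m). v \<noteq> 0\<^sub>v (Suc m) \<and> A *\<^sub>v v = \<mu> \<cdot>\<^sub>v (B *\<^sub>v v)"
    then obtain v where v: "v \<in> mean_zero (Suc m)" "v \<noteq> 0\<^sub>v (Suc m)" "A *\<^sub>v v = \<mu> \<cdot>\<^sub>v (B *\<^sub>v v)"
      by blast
    then obtain w c where w: "w \<in> carrier_vec m" "v = ext0 w + c \<cdot>\<^sub>v ones (Suc m)"
      using ext0_decomp[of v m] by (auto simp: mean_zero_def)
    have "w \<noteq> 0\<^sub>v m"
    proof
      assume "w = 0\<^sub>v m"
      then have "v = c \<cdot>\<^sub>v ones (Suc m)"
        using w by (intro eq_vecI) (auto simp: ext0_def)
      then show False
        using v mean_zero_const[of c m] by auto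
    qed
    moreover have "A *\<^sub>v ext0 w = \<mu> \<cdot>\<^sub>v (B *\<^sub>v ext0 w)"
      using v(3) w sym_null_const_shift(1)[OF A, of "ext0 w" c]
        sym_null_const_shift(1)[OF B, of "ext0 w" c] by simp
    ultimately show "\<exists>w\<in>carrier_vec m. w \<noteq> 0\<^sub>v m \<and> ground A *\<^sub>v w = \<mu> \<cdot>\<^sub>v (ground B *\<^sub>v w)"
      using w eigen_iff_ground by blast
  next
    assume "\<exists>w\<in>carrier_vec m. w \<noteq> 0\<^sub>v m \<and> ground A *\<^sub>v w = \<mu> \<cdot>\<^sub>v (ground B *\<^sub>v w)"
    then obtain w where w: "w \<in> carrier_vec m" "w \<noteq> 0\<^sub>v m"
      "A *\<^sub>v ext0 w = \<mu> \<cdot>\<^sub>v (B *\<^sub>v ext0 w)"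
      using eigen_iff_ground by blast
    obtain c where c: "ext0 w + c \<cdot>\<^sub>v ones (Suc m) \<in> mean_zero (Suc m)"
      using mean_zero_shift[of "ext0 w" m] w by auto
    \<comment> \<open>The shifted vector is nonzero because its \<open>B\<close>-form, which
      shifting leaves unchanged, is positive.\<close>
    have "0 < ext0 w \<bullet> (B *\<^sub>v ext0 w)"
      using w ground_B_pos ext0_scalar_prod[of B m w w] by simp
    then have "(ext0 w + c \<cdot>\<^sub>v ones (Suc m)) \<bullet> (B *\<^sub>v (ext0 w + c \<cdot>\<^sub>v ones (Suc m))) \<noteq> 0"
      using sym_null_const_shift(2)[OF B, of "ext0 w" c] w by simp
    then have "ext0 w + c \<cdot>\<^sub>v ones (Suc m) \<noteq> 0\<^sub>v (Suc m)"
      by (metis carrier(2) mult_mat_vec_carrier scalar_prod_left_zero zero_carrier_vec)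
    then show "\<exists>v\<in>mean_zero (Suc m). v \<noteq> 0\<^sub>v (Suc m) \<and> A *\<^sub>v v = \<mu> \<cdot>\<^sub>v (B *\<^sub>v v)"
      using c w sym_null_const_shift(1)[OF A, of "ext0 w" c]
        sym_null_const_shift(1)[OF B, of "ext0 w" c]
      by (intro bexI[of _ "ext0 w + c \<cdot>\<^sub>v ones (Suc m)"]) auto
  qed
qed

lemma ground_sym:
  assumes "w \<in> carrier_vec m" "w' \<in> carrier_vec m"
  shows "w \<bullet> (ground A *\<^sub>v w') = w' \<bullet> (ground A *\<^sub>v w)"
    and "w \<bullet> (ground B *\<^sub>v w') = w' \<bullet> (ground B *\<^sub>v w)"
  using A B assms unfolding sym_null_const_def
  by (simp_all flip: ext0_scalar_prod[of _ m])

text \<open>Multiplying by the inverse of \<open>ground B\<close> turns the eigenvalues of the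
  pencil into ordinary eigenvalues of a single \<open>m\<close> by \<open>m\<close> matrix.\<close>

lemma finite_precond_eigenvalues: "finite (precond_eigenvalues B A)"
proof -
  obtain N where N: "N \<in> carrier_mat m m" "N * ground B = 1\<^sub>m m"
    using ex_ground_B_inverse by metis
  have "precond_eigenvalues B A \<subseteq> spectrum (N * ground A)"
  proof
    fix \<mu> assume "\<mu> \<in> precond_eigenvalues B A"
    then obtain w where w: "w \<in> carrier_vec m" "w \<noteq> 0\<^sub>v m"
      "ground A *\<^sub>v w = \<mu> \<cdot>\<^sub>v (ground B *\<^sub>v w)"
      by (auto simp: precond_eigenvalues_eq_ground)
    have "(N * ground A) *\<^sub>v w = N *\<^sub>v (\<mu> \<cdot>\<^sub>v (ground B *\<^sub>v w))"
      using N(1) w by (simp add: assoc_mult_mat_vec[of _ m m _ m])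
    also have "\<dots> = \<mu> \<cdot>\<^sub>v (N *\<^sub>v (ground B *\<^sub>v w))"
      using N(1) w by (intro mult_mat_vec) auto
    also have "\<dots> = \<mu> \<cdot>\<^sub>v w"
      using N w by (simp flip: assoc_mult_mat_vec[of _ m m _ m])
    finally show "\<mu> \<in> spectrum (N * ground A)"
      using N(1) w by (auto simp: spectrum_def eigenvalue_def eigenvector_def)
  qed
  then show ?thesis
    using card_finite_spectrum(1)[of "N * ground A" m] N(1) by (meson finite_subset ground_carrier' mult_carrier_mat)
qed

text \<open>A complex eigenvalue of the pencil exists; symmetry forces its imaginary part to vanish.\<close>

lemma precond_eigenvalues_nonempty: "precond_eigenvalues B A \<noteq> {}"
proof -
  obtain N where N: "N \<in> carrier_mat m m" "ground B * N = 1\<^sub>m m"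
    using ex_ground_B_inverse by metis
  \<comment> \<open>\<open>C\<close> is self-adjoint for the form of \<open>ground B\<close> but
    need not be a symmetric matrix, so the argument returns to \<open>ground A\<close> and
    \<open>ground B\<close> after splitting a complex eigenvector into \<open>x\<close> and
    \<open>y\<close>.\<close>
  define C where "C = N * ground A"
  have C: "C \<in> carrier_mat m m"
    using N by (auto simp: C_def)
  have BC: "ground B *\<^sub>v (C *\<^sub>v x) = ground A *\<^sub>v x" if "x \<in> carrier_vec m" for x
  proof -
    have "ground B *\<^sub>v (C *\<^sub>v x) = (ground B * N) *\<^sub>v (ground A *\<^sub>v x)"
      using that N(1) ground_carrier' unfolding C_def by (simp add: assoc_mult_mat_vec[of _ m m _ m])
    then show ?thesis
      using N(2) that by simp
  qed
  let ?C = "map_mat complex_of_real C"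
  obtain \<mu> z where z: "z \<in> carrier_vec m" "z \<noteq> 0\<^sub>v m" "?C *\<^sub>v z = \<mu> \<cdot>\<^sub>v z"
    using spectrum_non_empty[of ?C m] C m_pos
    by (auto simp: spectrum_def eigenvalue_def eigenvector_def)
  define x y where "x = map_vec Re z" and "y = map_vec Im z"
  define a b where "a = Re \<mu>" and "b = Im \<mu>"
  have xy: "x \<in> carrier_vec m" "y \<in> carrier_vec m"
    using z by (auto simp: x_def y_def)
  have i: "(\<Sum>j<m. complex_of_real (C $$ (i, j)) * z $ j) = \<mu> * z $ i" if "i < m" for i
  proof -
    have "(?C *\<^sub>v z) $ i = (\<Sum>j<m. complex_of_real (C $$ (i, j)) * z $ j)"
      using that C z(1) by (simp add: scalar_prod_def lessThan_atLeast0)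
    then show ?thesis
      using that z by simp
  qed
  have Cx: "C *\<^sub>v x = a \<cdot>\<^sub>v x - b \<cdot>\<^sub>v y"
  proof (rule eq_vecI)
    fix k assume "k < dim_vec (a \<cdot>\<^sub>v x - b \<cdot>\<^sub>v y)"
    then have k: "k < m" using xy by simp
    show "(C *\<^sub>v x) $ k = (a \<cdot>\<^sub>v x - b \<cdot>\<^sub>v y) $ k"
      using arg_cong[OF i[OF k], of Re] k C z
      by (simp add: scalar_prod_def x_def y_def a_def b_def lessThan_atLeast0)
  qed (use C xy in simp)
  have Cy: "C *\<^sub>v y = b \<cdot>\<^sub>v x + a \<cdot>\<^sub>v y"
  proof (rule eq_vecI)
    fix k assume "k < dim_vec (b \<cdot>\<^sub>v x + a \<cdot>\<^sub>v y)"
    then have k: "k < m" using xy by simp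
    show "(C *\<^sub>v y) $ k = (b \<cdot>\<^sub>v x + a \<cdot>\<^sub>v y) $ k"
      using arg_cong[OF i[OF k], of Im] k C z
      by (simp add: scalar_prod_def x_def y_def a_def b_def lessThan_atLeast0)
  qed (use C xy in simp)
  let ?B = "ground B"
  have Bc: "?B *\<^sub>v x \<in> carrier_vec m" "?B *\<^sub>v y \<in> carrier_vec m"
    using mult_mat_vec_carrier[OF ground_carrier'(2)] xy by auto
  have Ax: "ground A *\<^sub>v x = a \<cdot>\<^sub>v (?B *\<^sub>v x) - b \<cdot>\<^sub>v (?B *\<^sub>v y)"
    unfolding BC[OF xy(1), symmetric] Cx using xy
    by (simp add: mult_minus_distrib_mat_vec[of _ m m] mult_mat_vec[of _ m m])
  have Ay: "ground A *\<^sub>v y = b \<cdot>\<^sub>v (?B *\<^sub>v x) + a \<cdot>\<^sub>v (?B *\<^sub>v y)"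
    unfolding BC[OF xy(2), symmetric] Cy using xy
    by (simp add: mult_add_distrib_mat_vec[of _ m m] mult_mat_vec[of _ m m])
  have "y \<bullet> (ground A *\<^sub>v x) = a * (y \<bullet> (?B *\<^sub>v x)) - b * (y \<bullet> (?B *\<^sub>v y))"
    unfolding Ax using xy Bc by (simp add: scalar_prod_minus_distrib[of _ m])
  moreover have "x \<bullet> (ground A *\<^sub>v y) = b * (x \<bullet> (?B *\<^sub>v x)) + a * (x \<bullet> (?B *\<^sub>v y))"
    unfolding Ay using xy Bc by (simp add: scalar_prod_add_distrib[of _ m])
  \<comment> \<open>By symmetry of \<open>ground A\<close> the two left-hand sides agree, and by
    symmetry of \<open>ground B\<close> the terms with \<open>a\<close> cancel. The factor of
    \<open>b\<close> is positive once \<open>x\<close> or \<open>y\<close> is nonzero.\<close>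
  ultimately have sum0: "b * (x \<bullet> (?B *\<^sub>v x) + y \<bullet> (?B *\<^sub>v y)) = 0"
    using ground_sym[of x y] xy by (simp add: algebra_simps)
  have nz: "x \<noteq> 0\<^sub>v m \<or> y \<noteq> 0\<^sub>v m"
  proof (rule ccontr)
    assume "\<not> (x \<noteq> 0\<^sub>v m \<or> y \<noteq> 0\<^sub>v m)"
    then have "x $ j = 0" "y $ j = 0" if "j < m" for j
      using that by auto
    then have "z = 0\<^sub>v m"
      using z(1) by (intro eq_vecI) (auto simp: x_def y_def complex_eq_iff)
    then show False using z by simp
  qed
  have nonneg: "0 \<le> w \<bullet> (?B *\<^sub>v w)" if "w \<in> carrier_vec m" for w
    using ground_B_pos[OF that] ground_carrier'(2) that by (cases "w = 0\<^sub>v m") auto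
  have "b = 0"
    using sum0 nz nonneg[OF xy(1)] nonneg[OF xy(2)] ground_B_pos[OF xy(1)] ground_B_pos[OF xy(2)]
    by (smt (verit) mult_eq_0_iff)
  then have "ground A *\<^sub>v x = a \<cdot>\<^sub>v (?B *\<^sub>v x)" "ground A *\<^sub>v y = a \<cdot>\<^sub>v (?B *\<^sub>v y)"
    using Ax Ay Bc by auto
  then have "a \<in> precond_eigenvalues B A"
    using nz xy by (auto simp: precond_eigenvalues_eq_ground)
  then show ?thesis by blast
qed

text \<open>Every eigenvalue is the Rayleigh quotient of \<open>A\<close> and \<open>B\<close> at
  its eigenvector, whose denominator is positive.\<close>

lemma precond_cond_le:
  assumes c: "0 < c"
    and lower: "\<And>v. v \<in> carrier_vec (Suc m) \<Longrightarrow> c * (v \<bullet> (B *\<^sub>v v)) \<le> v \<bullet> (A *\<^sub>v v)"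
    and upper: "\<And>v. v \<in> carrier_vec (Suc m) \<Longrightarrow> v \<bullet> (A *\<^sub>v v) \<le> d * (v \<bullet> (B *\<^sub>v v))"
  shows "precond_cond B A \<le> d / c"
proof -
  let ?E = "precond_eigenvalues B A"
  have bounds: "c \<le> \<mu> \<and> \<mu> \<le> d" if \<mu>: "\<mu> \<in> ?E" for \<mu>
  proof -
    obtain v where v: "v \<in> mean_zero (Suc m)" "v \<noteq> 0\<^sub>v (Suc m)" "A *\<^sub>v v = \<mu> \<cdot>\<^sub>v (B *\<^sub>v v)"
      using \<mu> by (auto simp: precond_eigenvalues_eq)
    then have vc: "v \<in> carrier_vec (Suc m)"
      by (simp add: mean_zero_def)
    then have "v \<bullet> (A *\<^sub>v v) = \<mu> * (v \<bullet> (B *\<^sub>v v))"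
      unfolding v(3) using carrier(2) by simp
    then show ?thesis
      using lower[OF vc] upper[OF vc] B_pos_mean_zero[OF v(1,2)] by simp
  qed
  \<comment> \<open>The sign of the maximum is needed because shrinking a positive denominator
    enlarges a quotient only for a nonnegative numerator.\<close>
  have "Max ?E \<le> d" "c \<le> Min ?E" "0 \<le> Max ?E"
    using bounds finite_precond_eigenvalues precond_eigenvalues_nonempty c
    by (auto simp: Max_ge_iff intro: order.trans[OF less_imp_le])
  then show ?thesis
    unfolding precond_cond_def using c by (intro frac_le) auto
qed

end

section \<open>Quadratic forms of Kronecker products\<close>

lemma scalar_prod_mult_mat_vec:
  fixes M :: "real mat"
  assumes "M \<in> carrier_mat n n" "u \<in> carrier_vec n" "v \<in> carrier_vec n"
  shows "u \<bullet> (M *\<^sub>v v) = (\<Sum>r<n. \<Sum>c<n. u $ r * M $$ (r, c) * v $ c)"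
  using assms by (auto simp: scalar_prod_def lessThan_atLeast0 sum_distrib_left mult.assoc)

lemma form_add:
  fixes M N :: "real mat"
  assumes "M \<in> carrier_mat n n" "N \<in> carrier_mat n n" "u \<in> carrier_vec n" "v \<in> carrier_vec n"
  shows "u \<bullet> ((M + N) *\<^sub>v v) = u \<bullet> (M *\<^sub>v v) + u \<bullet> (N *\<^sub>v v)"
  using assms by (subst add_mult_distrib_mat_vec[of _ n n]) (auto simp: scalar_prod_add_distrib[of _ n])

lemma form_smult:
  fixes M :: "real mat"
  assumes "M \<in> carrier_mat n n" "u \<in> carrier_vec n" "v \<in> carrier_vec n"
  shows "u \<bullet> ((k \<cdot>\<^sub>m M) *\<^sub>v v) = k * (u \<bullet> (M *\<^sub>v v))"
  using assms by (simp add: scalar_prod_mult_mat_vec[of _ n] sum_distrib_left algebra_simps)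

lemma form_uminus:
  fixes M :: "real mat"
  assumes "M \<in> carrier_mat n n" "u \<in> carrier_vec n" "v \<in> carrier_vec n"
  shows "u \<bullet> ((- M) *\<^sub>v v) = - (u \<bullet> (M *\<^sub>v v))"
  using assms by (simp add: scalar_prod_mult_mat_vec[of _ n] sum_negf)

lemma form_sum:
  fixes M :: "nat \<Rightarrow> real mat"
  assumes "\<And>k. M k \<in> carrier_mat n n" "u \<in> carrier_vec n" "v \<in> carrier_vec n"
  shows "u \<bullet> (mat n n (\<lambda>(r, c). \<Sum>k<K. M k $$ (r, c)) *\<^sub>v v) = (\<Sum>k<K. u \<bullet> (M k *\<^sub>v v))"
proof -
  have "u \<bullet> (mat n n (\<lambda>(r, c). \<Sum>k<K. M k $$ (r, c)) *\<^sub>v v) =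
      (\<Sum>r<n. \<Sum>c<n. \<Sum>k<K. u $ r * M k $$ (r, c) * v $ c)"
    using assms by (simp add: scalar_prod_mult_mat_vec[of _ n] sum_distrib_left sum_distrib_right)
  also have "\<dots> = (\<Sum>r<n. \<Sum>k<K. \<Sum>c<n. u $ r * M k $$ (r, c) * v $ c)"
    by (intro sum.cong refl sum.swap)
  also have "\<dots> = (\<Sum>k<K. \<Sum>r<n. \<Sum>c<n. u $ r * M k $$ (r, c) * v $ c)"
    by (rule sum.swap)
  finally show ?thesis
    using assms by (simp add: scalar_prod_mult_mat_vec[of _ n])
qed

section \<open>Kronecker products acting on grid functions\<close>

definition grid :: "nat \<Rightarrow> real vec \<Rightarrow> nat \<Rightarrow> nat \<Rightarrow> real" where
  "grid m v i j = v $ (i * m + j)"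

lemma grid_index_less: "i < m \<Longrightarrow> j < m \<Longrightarrow> i * m + j < m * (m :: nat)"
proof -
  assume "i < m" "j < m"
  then have "i * m + j < Suc i * m" by simp
  also have "\<dots> \<le> m * m" using \<open>i < m\<close> by (intro mult_le_mono1) simp
  finally show ?thesis .
qed

lemma sum_grid: "(\<Sum>r<m * m. f (r div m) (r mod m)) = (\<Sum>i<m. \<Sum>j<m. f i j)"
  for f :: "nat \<Rightarrow> nat \<Rightarrow> 'a::comm_monoid_add"
  unfolding sum.cartesian_product
proof (rule sum.reindex_bij_witness[of _ "\<lambda>(i, j). i * m + j" "\<lambda>r. (r div m, r mod m)"])
  fix r assume r: "r \<in> {..<m * m}"
  then have "0 < m" by (cases m) auto
  then show "(r div m, r mod m) \<in> {..<m} \<times> {..<m}"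
    using r by (auto simp: less_mult_imp_div_less)
qed (auto simp: grid_index_less)

lemma kronecker_carrier [simp]:
  "M \<in> carrier_mat m m \<Longrightarrow> N \<in> carrier_mat m m \<Longrightarrow> M \<otimes>\<^sub>K N \<in> carrier_mat (m * m) (m * m)"
  by (auto simp: kronecker_def)

lemma kronecker_form:
  assumes M: "M \<in> carrier_mat m m" and N: "N \<in> carrier_mat m m"
    and u: "u \<in> carrier_vec (m * m)" and v: "v \<in> carrier_vec (m * m)"
  shows "u \<bullet> ((M \<otimes>\<^sub>K N) *\<^sub>v v) = (\<Sum>i<m. \<Sum>j<m. \<Sum>i'<m. \<Sum>j'<m.
    grid m u i j * (M $$ (i, i') * N $$ (j, j')) * grid m v i' j')"
proof -
  have "u \<bullet> ((M \<otimes>\<^sub>K N) *\<^sub>v v) = (\<Sum>r<m*m. \<Sum>c<m*m. u $ r * (M \<otimes>\<^sub>K N) $$ (r, c) * v $ c)"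
    using assms by (intro scalar_prod_mult_mat_vec) auto
  also have "\<dots> = (\<Sum>r<m*m. \<Sum>c<m*m. grid m u (r div m) (r mod m) *
      (M $$ (r div m, c div m) * N $$ (r mod m, c mod m)) * grid m v (c div m) (c mod m))"
    using M N by (intro sum.cong refl) (auto simp: kronecker_def grid_def)
  also have "\<dots> = (\<Sum>r<m*m. \<Sum>i'<m. \<Sum>j'<m. grid m u (r div m) (r mod m) *
      (M $$ (r div m, i') * N $$ (r mod m, j')) * grid m v i' j')"
    by (subst sum_grid) rule
  also have "\<dots> = (\<Sum>i<m. \<Sum>j<m. \<Sum>i'<m. \<Sum>j'<m.
    grid m u i j * (M $$ (i, i') * N $$ (j, j')) * grid m v i' j')"
    by (rule sum_grid)
  finally show ?thesis .
qed

text \<open>\<open>M\<close> is \<open>w\<close> times the sum of the outer products of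
  \<open>a s\<close> with itself. Keeping \<open>w\<close> outside allows the weight -1, and the
  free index type allows sums over pairs.\<close>

definition rank_one_sum ::
    "nat \<Rightarrow> real mat \<Rightarrow> real \<Rightarrow> 's set \<Rightarrow> ('s \<Rightarrow> nat \<Rightarrow> real) \<Rightarrow> bool" where
  "rank_one_sum m M w S a \<longleftrightarrow> M \<in> carrier_mat m m \<and>
     (\<forall>i<m. \<forall>i'<m. M $$ (i, i') = w * (\<Sum>s\<in>S. a s i * a s i'))"

text \<open>The pairing of the grid function \<open>f\<close> with the simple tensor of
  \<open>a\<close> and \<open>b\<close>.\<close>

definition tensor_eval ::
    "nat \<Rightarrow> (nat \<Rightarrow> real) \<Rightarrow> (nat \<Rightarrow> real) \<Rightarrow> (nat \<Rightarrow> nat \<Rightarrow> real) \<Rightarrow> real" where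
  "tensor_eval m a b f = (\<Sum>i<m. \<Sum>j<m. a i * b j * f i j)"

text \<open>The Kronecker product of two outer squares is the outer square of the simple tensor, and
  the form of an outer square is a product of two pairings.\<close>

lemma kronecker_rank_one_sum:
  assumes M: "rank_one_sum m M w S a" and N: "rank_one_sum m N w' T b"
    and u: "u \<in> carrier_vec (m * m)" and v: "v \<in> carrier_vec (m * m)"
  shows "u \<bullet> ((M \<otimes>\<^sub>K N) *\<^sub>v v) = w * w' *
    (\<Sum>s\<in>S. \<Sum>t\<in>T. tensor_eval m (a s) (b t) (grid m u) * tensor_eval m (a s) (b t) (grid m v))"
proof -
  let ?f = "grid m u" and ?g = "grid m v"
  let ?h = "\<lambda>i j i' j' s t. (a s i * b t j * ?f i j) * (a s i' * b t j' * ?g i' j')"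
  have "u \<bullet> ((M \<otimes>\<^sub>K N) *\<^sub>v v) = (\<Sum>i<m. \<Sum>j<m. \<Sum>i'<m. \<Sum>j'<m.
      ?f i j * (M $$ (i, i') * N $$ (j, j')) * ?g i' j')"
    using assms by (intro kronecker_form) (auto simp: rank_one_sum_def)
  also have "\<dots> = (\<Sum>i<m. \<Sum>j<m. \<Sum>i'<m. \<Sum>j'<m. w * w' * (\<Sum>s\<in>S. \<Sum>t\<in>T. ?h i j i' j' s t))"
  proof (intro sum.cong refl)
    fix i j i' j' assume "i \<in> {..<m}" "j \<in> {..<m}" "i' \<in> {..<m}" "j' \<in> {..<m}"
    then have "?f i j * (M $$ (i, i') * N $$ (j, j')) * ?g i' j' = w * w' *
        (?f i j * ?g i' j' * ((\<Sum>s\<in>S. a s i * a s i') * (\<Sum>t\<in>T. b t j * b t j')))"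
      using M N by (simp add: rank_one_sum_def)
    also have "\<dots> = w * w' * (\<Sum>s\<in>S. \<Sum>t\<in>T. ?h i j i' j' s t)"
      unfolding sum_product by (simp add: sum_distrib_left mult_ac)
    finally show "?f i j * (M $$ (i, i') * N $$ (j, j')) * ?g i' j' =
        w * w' * (\<Sum>s\<in>S. \<Sum>t\<in>T. ?h i j i' j' s t)" .
  qed
  also have "\<dots> = w * w' * (\<Sum>i<m. \<Sum>j<m. \<Sum>i'<m. \<Sum>j'<m. \<Sum>s\<in>S. \<Sum>t\<in>T. ?h i j i' j' s t)"
    by (simp only: sum_distrib_left)
  \<comment> \<open>Packing the six indices into three pairs reduces the reordering to two exchanges
    of sums.\<close>
  also have "(\<Sum>i<m. \<Sum>j<m. \<Sum>i'<m. \<Sum>j'<m. \<Sum>s\<in>S. \<Sum>t\<in>T. ?h i j i' j' s t) =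
      (\<Sum>p\<in>{..<m} \<times> {..<m}. \<Sum>p'\<in>{..<m} \<times> {..<m}. \<Sum>q\<in>S \<times> T.
        ?h (fst p) (snd p) (fst p') (snd p') (fst q) (snd q))"
    by (simp only: sum.cartesian_product' fst_conv snd_conv)
  also have "\<dots> = (\<Sum>p\<in>{..<m} \<times> {..<m}. \<Sum>q\<in>S \<times> T. \<Sum>p'\<in>{..<m} \<times> {..<m}.
        ?h (fst p) (snd p) (fst p') (snd p') (fst q) (snd q))"
    by (intro sum.cong refl sum.swap)
  also have "\<dots> = (\<Sum>q\<in>S \<times> T. \<Sum>p\<in>{..<m} \<times> {..<m}. \<Sum>p'\<in>{..<m} \<times> {..<m}.
        ?h (fst p) (snd p) (fst p') (snd p') (fst q) (snd q))"
    by (rule sum.swap)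
  also have "\<dots> = (\<Sum>q\<in>S \<times> T. tensor_eval m (a (fst q)) (b (snd q)) ?f *
      tensor_eval m (a (fst q)) (b (snd q)) ?g)"
    by (simp add: tensor_eval_def sum.cartesian_product case_prod_unfold sum_product)
  also have "\<dots> = (\<Sum>s\<in>S. \<Sum>t\<in>T. tensor_eval m (a s) (b t) ?f * tensor_eval m (a s) (b t) ?g)"
    by (simp add: sum.cartesian_product case_prod_unfold)
  finally show ?thesis .
qed

section \<open>One-dimensional factors as sums of rank-one matrices\<close>

abbreviation ind :: "nat \<Rightarrow> nat \<Rightarrow> real" where
  "ind s \<equiv> \<lambda>i. of_bool (i = s)"

text \<open>The incidence vector of the edge from \<open>s\<close> to \<open>s'\<close>; its outer
  square is the Laplacian of this single edge.\<close>

abbreviation dif :: "nat \<Rightarrow> nat \<Rightarrow> nat \<Rightarrow> real" where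
  "dif s s' \<equiv> \<lambda>i. of_bool (i = s') - of_bool (i = s)"

lemma tensor_eval_ind:
  assumes "s < m" "t < m"
  shows "tensor_eval m (ind s) (ind t) f = f s t"
proof -
  have "tensor_eval m (ind s) (ind t) f = (\<Sum>i<m. if i = s then (\<Sum>j<m. if j = t then f i j else 0) else 0)"
    unfolding tensor_eval_def by (intro sum.cong refl) (auto intro!: sum.cong)
  then show ?thesis
    using assms by simp
qed

lemma tensor_eval_diff_left: "tensor_eval m (\<lambda>i. a i - a' i) b f = tensor_eval m a b f - tensor_eval m a' b f"
  by (simp add: tensor_eval_def left_diff_distrib sum_subtractf)

lemma tensor_eval_diff_right: "tensor_eval m a (\<lambda>i. b i - b' i) f = tensor_eval m a b f - tensor_eval m a b' f"
  by (simp add: tensor_eval_def left_diff_distrib right_diff_distrib sum_subtractf)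

lemma tensor_eval_dif:
  assumes "s < m" "s' < m" "t < m"
  shows "tensor_eval m (dif s s') (ind t) f = f s' t - f s t"
    and "tensor_eval m (ind t) (dif s s') f = f t s' - f t s"
  using assms by (simp_all add: tensor_eval_diff_left tensor_eval_diff_right tensor_eval_ind)

text \<open>At most the term \<open>s = r - p\<close> survives. The guard \<open>p \<le> r\<close>
  excludes the spurious solution produced by truncated subtraction.\<close>

lemma sum_of_bool_shift:
  fixes S :: "nat set"
  assumes "finite S"
  shows "(\<Sum>s\<in>S. of_bool (r = s + p) * of_bool (c = s + q)) =
    (of_bool (p \<le> r \<and> r - p \<in> S \<and> c = r - p + q) :: real)"
proof -
  have "(\<Sum>s\<in>S. of_bool (r = s + p) * of_bool (c = s + q)) =
      (\<Sum>s\<in>S. if s = r - p then of_bool (p \<le> r \<and> c = r - p + q) else (0 :: real))"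
    by (intro sum.cong refl) auto
  then show ?thesis
    using assms by auto
qed

lemma rank_one_sum_one: "rank_one_sum m (1\<^sub>m m) 1 {..<m} ind"
  by (auto simp: rank_one_sum_def sum_of_bool_shift[of "{..<m}" _ 0 _ 0, simplified])

text \<open>\<open>periodic_P\<close> is minus the Laplacian of the wrap-around edge. For
  \<open>m = 1\<close> this edge would degenerate to a loop with zero incidence vector.\<close>

lemma rank_one_sum_periodic:
  assumes "2 \<le> m"
  shows "rank_one_sum m (periodic_P m) (-1) {()} (\<lambda>_. dif (m - 1) 0)"
  using assms by (auto simp: rank_one_sum_def periodic_P_def)

lemma sum_of_bool_interval:
  fixes i0 n p q r c :: nat
  shows "(\<Sum>s\<in>{i0..<i0 + n - 1}. of_bool (r = s + p) * of_bool (c = s + q)) =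
    (of_bool (i0 + p \<le> r \<and> r + 1 < i0 + n + p \<and> c + p = r + q) :: real)"
proof -
  have "p \<le> r \<and> r - p \<in> {i0..<i0 + n - 1} \<and> c = r - p + q \<longleftrightarrow>
      i0 + p \<le> r \<and> r + 1 < i0 + n + p \<and> c + p = r + q"
    unfolding atLeastLessThan_iff by arith
  then show ?thesis
    by (simp only: sum_of_bool_shift[OF finite_atLeastLessThan])
qed

lemma insert_block_index:
  assumes "M \<in> carrier_mat n n" "r < m" "c < m"
  shows "insert_block m i0 M $$ (r, c) =
    (if (i0 \<le> r \<and> r < i0 + n) \<and> i0 \<le> c \<and> c < i0 + n then M $$ (r - i0, c - i0) else 0)"
  using assms by (simp add: insert_block_def)

lemma neumann_Q_carrier [simp]: "neumann_Q m \<in> carrier_mat m m"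
  by (simp add: neumann_Q_def tridiag_def mat_diag_def)

lemma neumann_I_carrier [simp]: "neumann_I m \<in> carrier_mat m m"
  by (simp add: neumann_I_def mat_diag_def)

lemma insert_block_carrier [simp]: "insert_block m i M \<in> carrier_mat m m"
  by (simp add: insert_block_def)

text \<open>\<open>neumann_Q n\<close> is minus the Laplacian of a path with \<open>n\<close> nodes
  and \<open>n - 1\<close> edges; the corner corrections account for the end nodes having one
  neighbour only.\<close>

lemma rank_one_sum_neumann_Q:
  assumes "2 \<le> n" "i0 + n \<le> m"
  shows "rank_one_sum m (insert_block m i0 (neumann_Q n)) (-1) {i0..<i0 + n - 1} (\<lambda>s. dif s (Suc s))"
  unfolding rank_one_sum_def
proof (intro conjI allI impI)
  fix r c assume rc: "r < m" "c < m"
  let ?S = "{i0..<i0 + n - 1}"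
  have "(\<Sum>s\<in>?S. dif s (Suc s) r * dif s (Suc s) c) =
      (\<Sum>s\<in>?S. (of_bool (r = s + 1) * of_bool (c = s + 1) - of_bool (r = s + 1) * of_bool (c = s + 0))
        - (of_bool (r = s + 0) * of_bool (c = s + 1) - of_bool (r = s + 0) * of_bool (c = s + 0)))"
    by (intro sum.cong refl) (simp only: left_diff_distrib right_diff_distrib Suc_eq_plus1 add_0_right)
  also have "\<dots> = (of_bool (i0 < r \<and> r < i0 + n \<and> c = r) - of_bool (i0 < r \<and> r < i0 + n \<and> c + 1 = r))
      - (of_bool (i0 \<le> r \<and> r + 1 < i0 + n \<and> c = r + 1) - of_bool (i0 \<le> r \<and> r + 1 < i0 + n \<and> c = r))"
    unfolding sum_subtractf sum_of_bool_interval by (simp add: Suc_le_eq)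
  finally have sum_eq: "(\<Sum>s\<in>?S. dif s (Suc s) r * dif s (Suc s) c) = \<dots>" .
  show "insert_block m i0 (neumann_Q n) $$ (r, c) =
      -1 * (\<Sum>s\<in>?S. dif s (Suc s) r * dif s (Suc s) c)"
  proof (cases "(i0 \<le> r \<and> r < i0 + n) \<and> i0 \<le> c \<and> c < i0 + n")
    case True
    then obtain x y where xy: "r = i0 + x" "c = i0 + y" "x < n" "y < n"
      by (metis add_less_cancel_left le_iff_add)
    have last: "x = n - 1 \<longleftrightarrow> x + 1 = n"
      using xy by linarith
    have "insert_block m i0 (neumann_Q n) $$ (r, c) =
        (if x = y + 1 then 1 else if x = y then -2 else if y = x + 1 then 1 else 0) +
        (if x = y then if x = 0 \<or> x = n - 1 then 1 else 0 else 0)"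
      using rc xy by (simp add: insert_block_index[of _ n] neumann_Q_def tridiag_def mat_diag_def)
    moreover have "(\<Sum>s\<in>?S. dif s (Suc s) r * dif s (Suc s) c) =
        (of_bool (0 < x \<and> y = x) - of_bool (0 < x \<and> y + 1 = x))
        - (of_bool (x + 1 < n \<and> y = x + 1) - of_bool (x + 1 < n \<and> y = x))"
      unfolding sum_eq unfolding xy(1,2) using xy(3)
      by (simp only: add.assoc add_less_cancel_left add_left_cancel le_add1 less_add_same_cancel1) simp
    \<comment> \<open>Two off-diagonals, then the first, last and inner diagonal entries, then the
      zeros. Since \<open>n\<close> is at least 2, the first and the last node differ.\<close>
    moreover consider "x = y + 1" | "y = x + 1" | "x = y" "x = 0" | "x = y" "x + 1 = n" "0 < x"
        | "x = y" "0 < x" "x + 1 < n" | "x \<noteq> y" "x \<noteq> y + 1" "y \<noteq> x + 1"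
      using xy by linarith
    then have "(if x = y + 1 then 1 else if x = y then -2 else if y = x + 1 then 1 else 0) +
        (if x = y then if x = 0 \<or> x + 1 = n then 1 else 0 else 0) =
        - 1 * ((of_bool (0 < x \<and> y = x) - of_bool (0 < x \<and> y + 1 = x))
        - (of_bool (x + 1 < n \<and> y = x + 1) - of_bool (x + 1 < n \<and> y = x)) :: real)"
      by cases (use xy assms in simp_all)
    ultimately show ?thesis
      unfolding last by (simp only:)
  next
    case False
    then have "insert_block m i0 (neumann_Q n) $$ (r, c) = 0"
      using rc by (simp only: insert_block_index[OF neumann_Q_carrier] if_False)
    moreover have "\<not> (i0 < r \<and> r < i0 + n \<and> c = r)" "\<not> (i0 < r \<and> r < i0 + n \<and> c + 1 = r)"
      "\<not> (i0 \<le> r \<and> r + 1 < i0 + n \<and> c = r + 1)" "\<not> (i0 \<le> r \<and> r + 1 < i0 + n \<and> c = r)"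
      using False by linarith+
    ultimately show ?thesis
      unfolding sum_eq by (simp only: if_False of_bool_def) simp
  qed
qed simp

text \<open>The trapezoidal rule: mesh interval \<open>s\<close> gives weight 1/2 to each endpoint
  \<open>s + e\<close>, so inner nodes collect 1 and end nodes keep 1/2.\<close>

lemma rank_one_sum_neumann_I:
  assumes "2 \<le> n" "i0 + n \<le> m"
  shows "rank_one_sum m (insert_block m i0 (neumann_I n)) (1 / 2) ({i0..<i0 + n - 1} \<times> {0, 1})
    (\<lambda>(s, e). ind (s + e))"
  unfolding rank_one_sum_def
proof (intro conjI allI impI)
  fix r c assume rc: "r < m" "c < m"
  let ?S = "{i0..<i0 + n - 1}"
  let ?sum = "\<Sum>p\<in>?S \<times> {0, 1}. (case p of (s, e) \<Rightarrow> ind (s + e)) r * (case p of (s, e) \<Rightarrow> ind (s + e)) c"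
  have two: "(\<Sum>e\<in>{0, 1 :: nat}. g e) = g 0 + g 1" for g :: "nat \<Rightarrow> real"
    by simp
  have "?sum = (\<Sum>s\<in>?S. of_bool (r = s + 0) * of_bool (c = s + 0)) +
      (\<Sum>s\<in>?S. of_bool (r = s + 1) * of_bool (c = s + 1))"
    by (simp only: sum.cartesian_product' two case_prod_conv sum.distrib)
  also have "\<dots> = of_bool (i0 \<le> r \<and> r + 1 < i0 + n \<and> c = r) + of_bool (i0 < r \<and> r < i0 + n \<and> c = r)"
    unfolding sum_of_bool_interval by (simp add: Suc_le_eq)
  finally have sum_eq: "?sum = \<dots>" .
  show "insert_block m i0 (neumann_I n) $$ (r, c) = 1 / 2 * ?sum"
  proof (cases "(i0 \<le> r \<and> r < i0 + n) \<and> i0 \<le> c \<and> c < i0 + n")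
    case True
    then obtain x y where xy: "r = i0 + x" "c = i0 + y" "x < n" "y < n"
      by (metis add_less_cancel_left le_iff_add)
    have last: "x = n - 1 \<longleftrightarrow> x + 1 = n"
      using xy by linarith
    have "insert_block m i0 (neumann_I n) $$ (r, c) =
        (if x = y then if x = 0 \<or> x = n - 1 then 1 / 2 else 1 else 0)"
      using rc xy by (simp add: insert_block_index[of _ n] neumann_I_def mat_diag_def)
    moreover have "?sum = of_bool (x + 1 < n \<and> y = x) + of_bool (0 < x \<and> y = x)"
      unfolding sum_eq unfolding xy(1,2) using xy(3)
      by (simp only: add.assoc add_less_cancel_left add_left_cancel le_add1 less_add_same_cancel1) simp
    moreover consider "x = y" "x = 0" | "x = y" "x + 1 = n" "0 < x"
        | "x = y" "0 < x" "x + 1 < n" | "x \<noteq> y"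
      using xy by linarith
    then have "(if x = y then if x = 0 \<or> x + 1 = n then 1 / 2 else 1 else 0) =
        1 / 2 * (of_bool (x + 1 < n \<and> y = x) + of_bool (0 < x \<and> y = x) :: real)"
      by cases (use xy assms in simp_all)
    ultimately show ?thesis
      unfolding last by (simp only:)
  next
    case False
    then have "insert_block m i0 (neumann_I n) $$ (r, c) = 0"
      using rc by (simp only: insert_block_index[OF neumann_I_carrier] if_False)
    moreover have "\<not> (i0 \<le> r \<and> r + 1 < i0 + n \<and> c = r)" "\<not> (i0 < r \<and> r < i0 + n \<and> c = r)"
      using False by linarith+
    ultimately show ?thesis
      unfolding sum_eq by (simp only: if_False of_bool_def) simp
  qed
qed simp

section \<open>Energy forms of the stiffness matrix\<close>

definition dx :: "(nat \<Rightarrow> nat \<Rightarrow> real) \<Rightarrow> nat \<Rightarrow> nat \<Rightarrow> real" where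
  "dx f i j = f (Suc i) j - f i j"

definition dy :: "(nat \<Rightarrow> nat \<Rightarrow> real) \<Rightarrow> nat \<Rightarrow> nat \<Rightarrow> real" where
  "dy f i j = f i (Suc j) - f i j"

definition mesh_square_form ::
    "(nat \<Rightarrow> nat \<Rightarrow> real) \<Rightarrow> (nat \<Rightarrow> nat \<Rightarrow> real) \<Rightarrow> nat \<Rightarrow> nat \<Rightarrow> real" where
  "mesh_square_form f g s t =
     (dx f s t * dx g s t + dx f s (Suc t) * dx g s (Suc t)
      + dy f s t * dy g s t + dy f (Suc s) t * dy g (Suc s) t) / 2"

text \<open>Here the difference matrix is paired with the identity instead of
  \<open>neumann_I\<close>, so edges on the boundary of the grid also have weight 1.\<close>

definition neumann_form :: "nat \<Rightarrow> (nat \<Rightarrow> nat \<Rightarrow> real) \<Rightarrow> (nat \<Rightarrow> nat \<Rightarrow> real) \<Rightarrow> real" where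
  "neumann_form m f g = (\<Sum>s<m - 1. \<Sum>t<m. dx f s t * dx g s t) + (\<Sum>s<m. \<Sum>t<m - 1. dy f s t * dy g s t)"

definition periodic_form :: "nat \<Rightarrow> (nat \<Rightarrow> nat \<Rightarrow> real) \<Rightarrow> (nat \<Rightarrow> nat \<Rightarrow> real) \<Rightarrow> real" where
  "periodic_form m f g =
     (\<Sum>t<m. (f 0 t - f (m - 1) t) * (g 0 t - g (m - 1) t)) +
     (\<Sum>s<m. (f s 0 - f s (m - 1)) * (g s 0 - g s (m - 1)))"

text \<open>A cell with \<open>m0\<close> nodes per direction contains \<open>m0 - 1\<close> mesh
  squares per direction, which explains the upper limits.\<close>

definition cells_form ::
    "nat \<Rightarrow> nat \<Rightarrow> (nat \<Rightarrow> nat) \<Rightarrow> (nat \<Rightarrow> nat) \<Rightarrow> (nat \<Rightarrow> nat \<Rightarrow> real) \<Rightarrow> (nat \<Rightarrow> nat \<Rightarrow> real) \<Rightarrow> real" where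
  "cells_form m0 K i1 i2 f g = (\<Sum>k<K. \<Sum>s\<in>{i1 k..<i1 k + m0 - 1}. \<Sum>t\<in>{i2 k..<i2 k + m0 - 1}.
     mesh_square_form f g s t)"

lemma periodic_P_carrier [simp]: "periodic_P m \<in> carrier_mat m m"
  by (simp add: periodic_P_def)

lemma cell_mat_carrier [simp]: "cell_mat m m0 i j \<in> carrier_mat (m * m) (m * m)"
  by (simp add: cell_mat_def)

text \<open>The factor \<open>neumann_Q\<close> supplies the difference along an edge and the minus
  sign; \<open>neumann_I\<close> supplies the two parallel edges of a mesh square with weight 1/2
  each.\<close>

lemma cell_mat_form:
  assumes "2 \<le> m0" "i + m0 \<le> m" "j + m0 \<le> m"
    and u: "u \<in> carrier_vec (m * m)" and v: "v \<in> carrier_vec (m * m)"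
  shows "u \<bullet> (cell_mat m m0 i j *\<^sub>v v) =
    - (\<Sum>s\<in>{i..<i + m0 - 1}. \<Sum>t\<in>{j..<j + m0 - 1}. mesh_square_form (grid m u) (grid m v) s t)"
proof -
  let ?S = "{i..<i + m0 - 1}" and ?T = "{j..<j + m0 - 1}" and ?f = "grid m u" and ?g = "grid m v"
  let ?QI = "insert_block m i (neumann_Q m0) \<otimes>\<^sub>K insert_block m j (neumann_I m0)"
  let ?IQ = "insert_block m i (neumann_I m0) \<otimes>\<^sub>K insert_block m j (neumann_Q m0)"
  have two: "(\<Sum>e\<in>{0, 1 :: nat}. h e) = h 0 + h 1" for h :: "nat \<Rightarrow> real"
    by simp
  have "u \<bullet> (?QI *\<^sub>v v) = - 1 * (1 / 2) * (\<Sum>s\<in>?S. \<Sum>p\<in>?T \<times> {0, 1}.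
      tensor_eval m (dif s (Suc s)) (case p of (t, e) \<Rightarrow> ind (t + e)) ?f *
      tensor_eval m (dif s (Suc s)) (case p of (t, e) \<Rightarrow> ind (t + e)) ?g)"
    using assms by (intro kronecker_rank_one_sum rank_one_sum_neumann_Q rank_one_sum_neumann_I) auto
  also have "(\<Sum>s\<in>?S. \<Sum>p\<in>?T \<times> {0, 1}.
      tensor_eval m (dif s (Suc s)) (case p of (t, e) \<Rightarrow> ind (t + e)) ?f *
      tensor_eval m (dif s (Suc s)) (case p of (t, e) \<Rightarrow> ind (t + e)) ?g) =
      (\<Sum>s\<in>?S. \<Sum>t\<in>?T. dx ?f s t * dx ?g s t + dx ?f s (Suc t) * dx ?g s (Suc t))"
    unfolding sum.cartesian_product' two case_prod_conv
    using assms by (intro sum.cong refl) (auto simp: tensor_eval_dif dx_def)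
  finally have QI: "u \<bullet> (?QI *\<^sub>v v) = - 1 * (1 / 2) *
      (\<Sum>s\<in>?S. \<Sum>t\<in>?T. dx ?f s t * dx ?g s t + dx ?f s (Suc t) * dx ?g s (Suc t))" .
  have "u \<bullet> (?IQ *\<^sub>v v) = 1 / 2 * - 1 * (\<Sum>p\<in>?S \<times> {0, 1}. \<Sum>t\<in>?T.
      tensor_eval m (case p of (s, e) \<Rightarrow> ind (s + e)) (dif t (Suc t)) ?f *
      tensor_eval m (case p of (s, e) \<Rightarrow> ind (s + e)) (dif t (Suc t)) ?g)"
    using assms by (intro kronecker_rank_one_sum rank_one_sum_neumann_Q rank_one_sum_neumann_I) auto
  also have "(\<Sum>p\<in>?S \<times> {0, 1}. \<Sum>t\<in>?T.
      tensor_eval m (case p of (s, e) \<Rightarrow> ind (s + e)) (dif t (Suc t)) ?f *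
      tensor_eval m (case p of (s, e) \<Rightarrow> ind (s + e)) (dif t (Suc t)) ?g) =
      (\<Sum>s\<in>?S. \<Sum>t\<in>?T. dy ?f s t * dy ?g s t + dy ?f (Suc s) t * dy ?g (Suc s) t)"
    unfolding sum.cartesian_product' two case_prod_conv sum.distrib[symmetric]
    using assms by (intro sum.cong refl) (auto simp: tensor_eval_dif dy_def)
  finally have IQ: "u \<bullet> (?IQ *\<^sub>v v) = 1 / 2 * - 1 *
      (\<Sum>s\<in>?S. \<Sum>t\<in>?T. dy ?f s t * dy ?g s t + dy ?f (Suc s) t * dy ?g (Suc s) t)" .
  have "u \<bullet> (cell_mat m m0 i j *\<^sub>v v) = u \<bullet> (?QI *\<^sub>v v) + u \<bullet> (?IQ *\<^sub>v v)"
    unfolding cell_mat_def using u v by (intro form_add) auto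
  also have "\<dots> = - (\<Sum>s\<in>?S. \<Sum>t\<in>?T. mesh_square_form ?f ?g s t)"
    unfolding QI IQ mesh_square_form_def
    by (simp add: sum.distrib sum_divide_distrib[symmetric] algebra_simps)
  finally show ?thesis .
qed

lemma periodic_P_form:
  assumes "2 \<le> m" and u: "u \<in> carrier_vec (m * m)" and v: "v \<in> carrier_vec (m * m)"
  shows "u \<bullet> ((periodic_P m \<otimes>\<^sub>K 1\<^sub>m m) *\<^sub>v v) + u \<bullet> ((1\<^sub>m m \<otimes>\<^sub>K periodic_P m) *\<^sub>v v) =
    - periodic_form m (grid m u) (grid m v)"
  using assms
  by (simp add: kronecker_rank_one_sum[OF rank_one_sum_periodic rank_one_sum_one]
      kronecker_rank_one_sum[OF rank_one_sum_one rank_one_sum_periodic]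
      tensor_eval_dif periodic_form_def sum_negf)

text \<open>Lets the path decomposition of an inserted block serve for the whole grid line.\<close>

lemma insert_block_full: "M \<in> carrier_mat m m \<Longrightarrow> insert_block m 0 M = M"
  by (intro eq_matI) (auto simp: insert_block_def)

lemma neumann_Q_form:
  assumes "2 \<le> m" and u: "u \<in> carrier_vec (m * m)" and v: "v \<in> carrier_vec (m * m)"
  shows "u \<bullet> ((neumann_Q m \<otimes>\<^sub>K 1\<^sub>m m) *\<^sub>v v) + u \<bullet> ((1\<^sub>m m \<otimes>\<^sub>K neumann_Q m) *\<^sub>v v) =
    - neumann_form m (grid m u) (grid m v)"
proof -
  have Q: "rank_one_sum m (neumann_Q m) (-1) {..<m - 1} (\<lambda>s. dif s (Suc s))"
    using rank_one_sum_neumann_Q[of m 0 m] assms by (simp add: insert_block_full lessThan_atLeast0)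
  have "u \<bullet> ((neumann_Q m \<otimes>\<^sub>K 1\<^sub>m m) *\<^sub>v v) =
      - (\<Sum>s<m - 1. \<Sum>t<m. dx (grid m u) s t * dx (grid m v) s t)"
    unfolding kronecker_rank_one_sum[OF Q rank_one_sum_one u v]
    by (auto simp: tensor_eval_dif dx_def intro!: sum.cong)
  moreover have "u \<bullet> ((1\<^sub>m m \<otimes>\<^sub>K neumann_Q m) *\<^sub>v v) =
      - (\<Sum>s<m. \<Sum>t<m - 1. dy (grid m u) s t * dy (grid m v) s t)"
    unfolding kronecker_rank_one_sum[OF rank_one_sum_one Q u v]
    by (auto simp: tensor_eval_dif dy_def intro!: sum.cong)
  ultimately show ?thesis
    by (simp add: neumann_form_def)
qed

lemma A_Delta_carrier [simp]: "A_Delta m \<in> carrier_mat (m * m) (m * m)"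
  by (simp add: A_Delta_def Delta1_def)

lemma kronecker_neg_add:
  assumes "M \<in> carrier_mat m m" "N \<in> carrier_mat m m" "R \<in> carrier_mat m m"
  shows "- (M + N) \<otimes>\<^sub>K R = - (M \<otimes>\<^sub>K R + N \<otimes>\<^sub>K R)"
    and "R \<otimes>\<^sub>K - (M + N) = - (R \<otimes>\<^sub>K M + R \<otimes>\<^sub>K N)"
proof -
  have less: "r div m < m \<and> r mod m < m" if "r < m * m" for r
    using that by (cases m) (auto simp: less_mult_imp_div_less)
  show "- (M + N) \<otimes>\<^sub>K R = - (M \<otimes>\<^sub>K R + N \<otimes>\<^sub>K R)"
    using assms less by (intro eq_matI) (auto simp: kronecker_def left_diff_distrib distrib_right)
  show "R \<otimes>\<^sub>K - (M + N) = - (R \<otimes>\<^sub>K M + R \<otimes>\<^sub>K N)"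
    using assms less by (intro eq_matI) (auto simp: kronecker_def right_diff_distrib distrib_left)
qed

lemma A_Delta_form:
  assumes "2 \<le> m" and u: "u \<in> carrier_vec (m * m)" and v: "v \<in> carrier_vec (m * m)"
  shows "u \<bullet> (A_Delta m *\<^sub>v v) =
    neumann_form m (grid m u) (grid m v) + periodic_form m (grid m u) (grid m v)"
proof -
  let ?Q = "neumann_Q m" and ?P = "periodic_P m" and ?I = "1\<^sub>m m :: real mat"
  have "u \<bullet> (A_Delta m *\<^sub>v v) =
      u \<bullet> ((Delta1 m \<otimes>\<^sub>K ?I) *\<^sub>v v) + u \<bullet> ((?I \<otimes>\<^sub>K Delta1 m) *\<^sub>v v)"
    unfolding A_Delta_def Delta1_def using u v by (intro form_add) auto
  also have "u \<bullet> ((Delta1 m \<otimes>\<^sub>K ?I) *\<^sub>v v) =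
      - (u \<bullet> ((?Q \<otimes>\<^sub>K ?I) *\<^sub>v v) + u \<bullet> ((?P \<otimes>\<^sub>K ?I) *\<^sub>v v))"
    using u v by (simp add: Delta1_def kronecker_neg_add[of _ m] form_uminus[of _ "m * m"] form_add[of _ "m * m"])
  also have "u \<bullet> ((?I \<otimes>\<^sub>K Delta1 m) *\<^sub>v v) =
      - (u \<bullet> ((?I \<otimes>\<^sub>K ?Q) *\<^sub>v v) + u \<bullet> ((?I \<otimes>\<^sub>K ?P) *\<^sub>v v))"
    using u v by (simp add: Delta1_def kronecker_neg_add[of _ m] form_uminus[of _ "m * m"] form_add[of _ "m * m"])
  finally show ?thesis
    using neumann_Q_form[OF assms] periodic_P_form[OF assms] by simp
qed

lemma A_s_carrier [simp]: "A_s m m0 K i1 i2 \<in> carrier_mat (m * m) (m * m)"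
  by (simp add: A_s_def)

lemma A_s_form:
  assumes m: "2 \<le> m0" "m0 \<le> m" and i: "\<And>k. k < K \<Longrightarrow> i1 k + m0 \<le> m \<and> i2 k + m0 \<le> m"
    and u: "u \<in> carrier_vec (m * m)" and v: "v \<in> carrier_vec (m * m)"
  shows "u \<bullet> (A_s m m0 K i1 i2 *\<^sub>v v) =
    cells_form m0 K i1 i2 (grid m u) (grid m v) + periodic_form m (grid m u) (grid m v)"
proof -
  let ?n = "m * m"
  let ?M = "mat ?n ?n (\<lambda>(r, c). \<Sum>k<K. cell_mat m m0 (i1 k) (i2 k) $$ (r, c))"
  let ?P = "periodic_P m \<otimes>\<^sub>K 1\<^sub>m m" and ?P' = "1\<^sub>m m \<otimes>\<^sub>K periodic_P m"
  have c: "?M \<in> carrier_mat ?n ?n" "?P \<in> carrier_mat ?n ?n" "?P' \<in> carrier_mat ?n ?n"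
    by simp_all
  have "u \<bullet> (A_s m m0 K i1 i2 *\<^sub>v v) = - (u \<bullet> (?M *\<^sub>v v) + (u \<bullet> (?P *\<^sub>v v) + u \<bullet> (?P' *\<^sub>v v)))"
    unfolding A_s_def using u v c by (simp add: form_uminus[of _ ?n] form_add[of _ ?n])
  also have "u \<bullet> (?M *\<^sub>v v) = - cells_form m0 K i1 i2 (grid m u) (grid m v)"
    using m i u v by (simp add: form_sum[of _ ?n] cell_mat_form cells_form_def sum_negf)
  also have "u \<bullet> (?P *\<^sub>v v) + u \<bullet> (?P' *\<^sub>v v) = - periodic_form m (grid m u) (grid m v)"
    using m u v by (intro periodic_P_form) auto
  finally show ?thesis by simp
qed

text \<open>The periodic edges have total weight \<open>lam + (1 - lam) = 1\<close>, whatever the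
  covered domain is.\<close>

lemma stiffness_form:
  assumes m: "2 \<le> m0" "m0 \<le> m" and i: "\<And>k. k < K \<Longrightarrow> i1 k + m0 \<le> m \<and> i2 k + m0 \<le> m"
    and u: "u \<in> carrier_vec (m * m)" and v: "v \<in> carrier_vec (m * m)"
  shows "u \<bullet> (stiffness lam m m0 K i1 i2 *\<^sub>v v) =
    lam * (neumann_form m (grid m u) (grid m v) + periodic_form m (grid m u) (grid m v)) +
    (1 - lam) * (cells_form m0 K i1 i2 (grid m u) (grid m v) + periodic_form m (grid m u) (grid m v))"
  using assms
  by (simp add: stiffness_def form_add[of _ "m * m"] form_smult[of _ "m * m"] A_Delta_form A_s_form)

lemma preconditioner_form:
  assumes "2 \<le> m" and u: "u \<in> carrier_vec (m * m)" and v: "v \<in> carrier_vec (m * m)"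
  shows "u \<bullet> (preconditioner lam m *\<^sub>v v) =
    (1 + lam) / 2 * (neumann_form m (grid m u) (grid m v) + periodic_form m (grid m u) (grid m v))"
  using assms by (simp add: preconditioner_def form_smult[of _ "m * m"] A_Delta_form)

lemma forms_sym:
  "neumann_form m f g = neumann_form m g f" "periodic_form m f g = periodic_form m g f"
  "cells_form m0 K i1 i2 f g = cells_form m0 K i1 i2 g f"
  by (simp_all add: neumann_form_def periodic_form_def cells_form_def mesh_square_form_def mult.commute)

text \<open>Constancy can be assumed only on the grid itself, as \<open>grid\<close> is meaningless
  beyond it; hence the cells must lie inside.\<close>

lemma forms_const:
  assumes "\<And>i j. i < m \<Longrightarrow> j < m \<Longrightarrow> g i j = c"
  shows "neumann_form m f g = 0" and "periodic_form m f g = 0"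
    and "(\<And>k. k < K \<Longrightarrow> i1 k + m0 \<le> m \<and> i2 k + m0 \<le> m) \<Longrightarrow> cells_form m0 K i1 i2 f g = 0"
proof -
  have x: "dx g s t = 0" if "Suc s < m" "t < m" for s t
    using that assms by (simp add: dx_def)
  have y: "dy g s t = 0" if "s < m" "Suc t < m" for s t
    using that assms by (simp add: dy_def)
  show "neumann_form m f g = 0"
    by (simp add: neumann_form_def x y less_diff_conv)
  show "periodic_form m f g = 0"
    using assms by (simp add: periodic_form_def)
  assume i: "\<And>k. k < K \<Longrightarrow> i1 k + m0 \<le> m \<and> i2 k + m0 \<le> m"
  have "mesh_square_form f g s t = 0"
    if "k < K" "s \<in> {i1 k..<i1 k + m0 - 1}" "t \<in> {i2 k..<i2 k + m0 - 1}" for k s t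
    using that i[of k] by (auto simp: mesh_square_form_def x y)
  then show "cells_form m0 K i1 i2 f g = 0"
    by (simp add: cells_form_def)
qed

section \<open>Positivity and comparison of the energies\<close>

lemma forms_nonneg:
  "0 \<le> neumann_form m f f" "0 \<le> periodic_form m f f" "0 \<le> cells_form m0 K i1 i2 f f"
    "0 \<le> mesh_square_form f f s t"
  by (simp_all add: neumann_form_def periodic_form_def cells_form_def mesh_square_form_def
      sum_nonneg add_nonneg_nonneg)

text \<open>All edge differences vanish and the grid graph is connected: walk from
  \<open>(i, j)\<close> to \<open>(0, j)\<close> and on to \<open>(0, 0)\<close>.\<close>

lemma neumann_form_definite:
  assumes "neumann_form m f f \<le> 0" "i < m" "j < m"
  shows "f i j = f 0 0"
proof -
  let ?X = "\<Sum>s<m - 1. \<Sum>t<m. dx f s t * dx f s t" and ?Y = "\<Sum>s<m. \<Sum>t<m - 1. dy f s t * dy f s t"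
  have "0 \<le> ?X" "0 \<le> ?Y"
    by (simp_all add: sum_nonneg)
  then have "?X = 0" "?Y = 0"
    using assms(1) by (simp_all add: neumann_form_def)
  then have "dx f s t = 0" if "Suc s < m" "t < m" for s t
    using that by (auto simp: sum_nonneg_eq_0_iff sum_nonneg)
  moreover have "dy f s t = 0" if "s < m" "Suc t < m" for s t
    using that \<open>?Y = 0\<close> by (auto simp: sum_nonneg_eq_0_iff sum_nonneg)
  ultimately have step: "\<And>s t. Suc s < m \<Longrightarrow> t < m \<Longrightarrow> f (Suc s) t = f s t"
      "\<And>s t. s < m \<Longrightarrow> Suc t < m \<Longrightarrow> f s (Suc t) = f s t"
    by (auto simp: dx_def dy_def)
  have "f i j = f 0 j"
    using assms(2,3) by (induction i) (auto simp: step)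
  also have "\<dots> = f 0 0"
    using assms(2,3) by (induction j) (auto simp: step)
  finally show ?thesis .
qed

lemma sum_pair_average_le:
  fixes x :: "nat \<Rightarrow> real"
  assumes "\<And>t. 0 \<le> x t"
  shows "(\<Sum>t<m - 1. (x t + x (Suc t)) / 2) \<le> (\<Sum>t<m. x t)"
proof (cases m)
  case (Suc n)
  \<comment> \<open>Each half of the average omits one nonnegative end term of the full sum.\<close>
  have "(\<Sum>t<n. x (Suc t)) \<le> (\<Sum>t<Suc n. x t)" "(\<Sum>t<n. x t) \<le> (\<Sum>t<Suc n. x t)"
    by (subst sum.lessThan_Suc_shift) (simp_all add: assms)
  then show ?thesis
    unfolding Suc by (simp add: sum_divide_distrib[symmetric] sum.distrib)
qed simp

lemma sum_mesh_squares_le_neumann_form: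
  "(\<Sum>s<m - 1. \<Sum>t<m - 1. mesh_square_form f f s t) \<le> neumann_form m f f"
proof -
  let ?x = "\<lambda>s t. dx f s t * dx f s t" and ?y = "\<lambda>s t. dy f s t * dy f s t"
  have "(\<Sum>s<m - 1. \<Sum>t<m - 1. mesh_square_form f f s t) =
      (\<Sum>s<m - 1. \<Sum>t<m - 1. (?x s t + ?x s (Suc t)) / 2) +
      (\<Sum>s<m - 1. \<Sum>t<m - 1. (?y s t + ?y (Suc s) t) / 2)"
    unfolding mesh_square_form_def sum.distrib[symmetric]
    by (intro sum.cong refl) (simp add: field_simps)
  \<comment> \<open>The paired \<open>y\<close>-edges differ in \<open>s\<close>, so
    \<open>s\<close> has to become the inner index before \<open>sum_pair_average_le\<close>
    applies.\<close>
  also have "\<dots> = (\<Sum>s<m - 1. \<Sum>t<m - 1. (?x s t + ?x s (Suc t)) / 2) +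
      (\<Sum>t<m - 1. \<Sum>s<m - 1. (?y s t + ?y (Suc s) t) / 2)"
    by (intro arg_cong2[where f = "(+)"] refl sum.swap)
  also have "\<dots> \<le> (\<Sum>s<m - 1. \<Sum>t<m. ?x s t) + (\<Sum>t<m - 1. \<Sum>s<m. ?y s t)"
    by (intro add_mono sum_mono sum_pair_average_le) simp_all
  also have "(\<Sum>t<m - 1. \<Sum>s<m. ?y s t) = (\<Sum>s<m. \<Sum>t<m - 1. ?y s t)"
    by (rule sum.swap)
  finally show ?thesis
    by (simp add: neumann_form_def)
qed

text \<open>Carries disjointness from the plane to indices: a mesh square shared by two cells would
  put its lower left corner into both, half-open cells containing these corners.\<close>

lemma disjoint_mesh_squares:
  assumes h: "0 < h"
    and disj: "disjoint_family_on (\<lambda>k. elementary_cell h m0 (i1 k) (i2 k)) I"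
  shows "disjoint_family_on (\<lambda>k. {i1 k..<i1 k + m0 - 1} \<times> {i2 k..<i2 k + m0 - 1}) I"
  unfolding disjoint_family_on_def
proof (intro ballI impI)
  fix k l assume kl: "k \<in> I" "l \<in> I" "k \<noteq> l"
  have mem: "(real s * h, real t * h) \<in> elementary_cell h m0 (i1 k) (i2 k)"
    if "s \<in> {i1 k..<i1 k + m0 - 1}" "t \<in> {i2 k..<i2 k + m0 - 1}" for s t k
    using that h by (auto simp: elementary_cell_def)
  show "{i1 k..<i1 k + m0 - 1} \<times> {i2 k..<i2 k + m0 - 1} \<inter>
      {i1 l..<i1 l + m0 - 1} \<times> {i2 l..<i2 l + m0 - 1} = {}"
  proof (rule ccontr)
    assume "\<not> ?thesis"
    then obtain s t where
      "s \<in> {i1 k..<i1 k + m0 - 1}" "t \<in> {i2 k..<i2 k + m0 - 1}"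
      "s \<in> {i1 l..<i1 l + m0 - 1}" "t \<in> {i2 l..<i2 l + m0 - 1}"
      by blast
    then have "(real s * h, real t * h) \<in>
        elementary_cell h m0 (i1 k) (i2 k) \<inter> elementary_cell h m0 (i1 l) (i2 l)"
      using mem[of s k t] mem[of s l t] by blast
    then show False
      using disj kl by (auto simp: disjoint_family_on_def)
  qed
qed

text \<open>Every mesh square lies in at most one cell, and an edge borders at most two mesh squares, each
  of which carries half of its energy.\<close>

lemma cells_form_le_neumann_form:
  assumes i: "\<And>k. k < K \<Longrightarrow> i1 k + m0 \<le> m \<and> i2 k + m0 \<le> m"
    and disj: "disjoint_family_on (\<lambda>k. {i1 k..<i1 k + m0 - 1} \<times> {i2 k..<i2 k + m0 - 1}) {..<K}"
  shows "cells_form m0 K i1 i2 f f \<le> neumann_form m f f"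
proof -
  let ?c = "\<lambda>k. {i1 k..<i1 k + m0 - 1} \<times> {i2 k..<i2 k + m0 - 1}"
  let ?F = "\<lambda>(s, t). mesh_square_form f f s t"
  have "cells_form m0 K i1 i2 f f = (\<Sum>k<K. sum ?F (?c k))"
    by (simp add: cells_form_def sum.cartesian_product)
  also have "\<dots> = sum ?F (\<Union>k<K. ?c k)"
    using disj by (intro sum.UNION_disjoint[symmetric]) (auto simp: disjoint_family_on_def)
  also have "\<dots> \<le> sum ?F ({..<m - 1} \<times> {..<m - 1})"
    using i by (intro sum_mono2) (fastforce simp: forms_nonneg)+
  also have "\<dots> = (\<Sum>s<m - 1. \<Sum>t<m - 1. mesh_square_form f f s t)"
    by (simp add: sum.cartesian_product)
  also have "\<dots> \<le> neumann_form m f f"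
    by (rule sum_mesh_squares_le_neumann_form)
  finally show ?thesis .
qed

text \<open>Testing against unit vectors recovers the kernel condition, so knowledge of the form
  suffices.\<close>

lemma sym_null_constI:
  assumes M: "M \<in> carrier_mat n n"
    and sym: "\<And>u v. u \<in> carrier_vec n \<Longrightarrow> v \<in> carrier_vec n \<Longrightarrow> u \<bullet> (M *\<^sub>v v) = v \<bullet> (M *\<^sub>v u)"
    and null: "\<And>u. u \<in> carrier_vec n \<Longrightarrow> u \<bullet> (M *\<^sub>v ones n) = 0"
  shows "sym_null_const n M"
proof -
  have "M *\<^sub>v ones n = 0\<^sub>v n"
  proof (rule eq_vecI)
    fix i assume i: "i < dim_vec (0\<^sub>v n :: real vec)"
    have "M *\<^sub>v ones n \<in> carrier_vec n"
      using M by (simp add: mult_mat_vec_carrier)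
    then have "(M *\<^sub>v ones n) $ i = unit_vec n i \<bullet> (M *\<^sub>v ones n)"
      using i by simp
    then show "(M *\<^sub>v ones n) $ i = 0\<^sub>v n $ i"
      using null[of "unit_vec n i"] i by simp
  qed (use M in simp)
  then show ?thesis
    using M sym by (simp add: sym_null_const_def)
qed

lemma grid_ones: "i < m \<Longrightarrow> j < m \<Longrightarrow> grid m (ones (m * m)) i j = 1"
  by (simp add: grid_def grid_index_less)

lemma grid_const_imp:
  assumes v: "v \<in> carrier_vec (m * m)" and c: "\<And>i j. i < m \<Longrightarrow> j < m \<Longrightarrow> grid m v i j = c"
  shows "v = c \<cdot>\<^sub>v ones (m * m)"
proof (rule eq_vecI)
  fix r assume "r < dim_vec (c \<cdot>\<^sub>v ones (m * m))"
  then have r: "r < m * m" by simp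
  then have "0 < m" by (cases m) auto
  then have "v $ r = c"
    using c[of "r div m" "r mod m"] r by (simp add: grid_def less_mult_imp_div_less)
  then show "v $ r = (c \<cdot>\<^sub>v ones (m * m)) $ r"
    using r by simp
qed (use v in simp)

section \<open>Spectral bounds for the preconditioned stiffness matrix\<close>

lemma precond_cond_stiffness_le:
  assumes lam: "0 < lam" "lam \<le> 1" and m: "2 \<le> m0" "m0 \<le> m"
    and i: "\<And>k. k < K \<Longrightarrow> i1 k + m0 \<le> m \<and> i2 k + m0 \<le> m"
    and disj: "disjoint_family_on (\<lambda>k. {i1 k..<i1 k + m0 - 1} \<times> {i2 k..<i2 k + m0 - 1}) {..<K}"
  shows "precond_cond (preconditioner lam m) (stiffness lam m m0 K i1 i2) \<le> inverse lam"
proof -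
  let ?A = "stiffness lam m m0 K i1 i2" and ?B = "preconditioner lam m"
  let ?n = "m * m"
  have m2: "2 \<le> m" using m by simp
  have n: "Suc (?n - 1) = ?n" "0 < ?n - 1"
    using m2 mult_le_mono[OF m2 m2] by auto
  have A: "?A \<in> carrier_mat ?n ?n" and B: "?B \<in> carrier_mat ?n ?n"
    by (simp_all add: stiffness_def preconditioner_def)
  note A_form = stiffness_form[OF m i] and B_form = preconditioner_form[OF m2]
  have "laplacian_pencil (?n - 1) ?A ?B"
  proof
    show "sym_null_const (Suc (?n - 1)) ?A"
      unfolding n using forms_const[of m "grid m (ones ?n)" 1, OF grid_ones] i
      by (intro sym_null_constI A) (simp_all add: A_form forms_sym)
    show "sym_null_const (Suc (?n - 1)) ?B"
      unfolding n using forms_const[of m "grid m (ones ?n)" 1, OF grid_ones]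
      by (intro sym_null_constI B) (simp_all add: B_form forms_sym)
  next
    fix v :: "real vec" assume v: "v \<in> carrier_vec (Suc (?n - 1))" "v \<bullet> (?B *\<^sub>v v) \<le> 0"
    then have vc: "v \<in> carrier_vec ?n" by (simp only: n)
    have "neumann_form m (grid m v) (grid m v) + periodic_form m (grid m v) (grid m v) \<le> 0"
      using v(2) lam by (simp add: B_form[OF vc vc] mult_le_0_iff)
    then have "neumann_form m (grid m v) (grid m v) \<le> 0"
      using forms_nonneg(2)[of m "grid m v"] by linarith
    then have "v = grid m v 0 0 \<cdot>\<^sub>v ones ?n"
      using vc by (intro grid_const_imp neumann_form_definite)
    then show "\<exists>c. v = c \<cdot>\<^sub>v ones (Suc (?n - 1))"
      unfolding n by blast
  qed (rule n)
  then interpret laplacian_pencil "?n - 1" ?A ?B .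
  have "precond_cond ?B ?A \<le> (2 / (1 + lam)) / (2 * lam / (1 + lam))"
  proof (rule precond_cond_le)
    show "0 < 2 * lam / (1 + lam)"
      using lam by simp
  next
    fix v :: "real vec" assume "v \<in> carrier_vec (Suc (?n - 1))"
    then have v: "v \<in> carrier_vec ?n" by (simp only: n)
    define N P C where "N = neumann_form m (grid m v) (grid m v)"
      and "P = periodic_form m (grid m v) (grid m v)"
      and "C = cells_form m0 K i1 i2 (grid m v) (grid m v)"
    have Af: "v \<bullet> (?A *\<^sub>v v) = lam * (N + P) + (1 - lam) * (C + P)"
      and Bf: "v \<bullet> (?B *\<^sub>v v) = (1 + lam) / 2 * (N + P)"
      using A_form[OF _ v v] B_form[OF v v] by (simp_all add: N_def P_def C_def)
    have CP: "0 \<le> C" "0 \<le> P" "C \<le> N"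
      using forms_nonneg cells_form_le_neumann_form[OF i disj] by (simp_all add: N_def P_def C_def)
    \<comment> \<open>The lower constant is chosen to turn the \<open>B\<close>-form into the first
      summand of the \<open>A\<close>-form; the second summand is nonnegative.\<close>
    have "2 * lam / (1 + lam) * (v \<bullet> (?B *\<^sub>v v)) = lam * (N + P)"
      using lam by (simp add: Bf field_simps)
    then show "2 * lam / (1 + lam) * (v \<bullet> (?B *\<^sub>v v)) \<le> v \<bullet> (?A *\<^sub>v v)"
      using CP lam by (simp add: Af)
    have "2 / (1 + lam) * (v \<bullet> (?B *\<^sub>v v)) = N + P"
      using lam by (simp add: Bf field_simps)
    \<comment> \<open>Replacing \<open>C\<close> by \<open>N\<close> turns the \<open>A\<close>-form
      into the convex combination
      \<open>lam * (N + P) + (1 - lam) * (N + P) = N + P\<close>.\<close>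
    moreover have "(1 - lam) * (C + P) \<le> (1 - lam) * (N + P)"
      using CP lam by (intro mult_left_mono) auto
    ultimately show "v \<bullet> (?A *\<^sub>v v) \<le> 2 / (1 + lam) * (v \<bullet> (?B *\<^sub>v v))"
      by (simp add: Af algebra_simps)
  qed
  also have "\<dots> = inverse lam"
  proof -
    have "lam \<noteq> 0" "1 + lam \<noteq> 0"
      using lam by linarith+
    then show ?thesis
      by (simp add: divide_simps)
  qed
  finally show ?thesis .
qed

theorem lemma3p3:
  shows "\<exists>C>0::real. \<forall>(lam::real) (m1::nat) (h::real) (L::nat) (\<alpha>::real) (G::(real \<times> real) set)
           (m0::nat) (K::nat) (i1::nat \<Rightarrow> nat) (i2::nat \<Rightarrow> nat).
         0 < lam \<and> lam \<le> 1 \<and> 1 \<le> L \<and> 0 < \<alpha> \<and> \<alpha> \<le> 1 / 2 \<and>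
         is_mesh_width m1 h \<and> is_realization h L \<alpha> G \<and>
         L\<^sup>2 \<le> K \<and> is_decomposition m1 h m0 K i1 i2 G \<longrightarrow>
           precond_cond (preconditioner lam m1) (stiffness lam m1 m0 K i1 i2) \<le> C * inverse lam"
proof (intro exI[of _ 1] conjI allI impI)
  fix lam h \<alpha> :: real and m1 L m0 K :: nat and i1 i2 :: "nat \<Rightarrow> nat" and G :: "(real \<times> real) set"
  assume *: "0 < lam \<and> lam \<le> 1 \<and> 1 \<le> L \<and> 0 < \<alpha> \<and> \<alpha> \<le> 1 / 2 \<and>
         is_mesh_width m1 h \<and> is_realization h L \<alpha> G \<and>
         L\<^sup>2 \<le> K \<and> is_decomposition m1 h m0 K i1 i2 G"
  then have m0: "2 \<le> m0" and i: "\<And>k. k < K \<Longrightarrow> i1 k + m0 \<le> m1 \<and> i2 k + m0 \<le> m1"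
    and disj: "disjoint_family_on (\<lambda>k. elementary_cell h m0 (i1 k) (i2 k)) {..<K}"
    by (auto simp: is_decomposition_def)
  \<comment> \<open>At least one cell exists, so the grid holds \<open>m0\<close> nodes in a row and
    \<open>m1\<close> is at least 2. This makes \<open>h\<close> positive under both conventions,
    including \<open>1 / (m1 - 1)\<close>.\<close>
  have "0 < L\<^sup>2" using * by simp
  then have "0 < K" using * by linarith
  then have "m0 \<le> m1" using i[of 0] by simp
  moreover from this have "0 < h"
    using * m0 by (auto simp: is_mesh_width_def)
  ultimately show "precond_cond (preconditioner lam m1) (stiffness lam m1 m0 K i1 i2) \<le> 1 * inverse lam"
    using precond_cond_stiffness_le[OF _ _ m0 _ i disjoint_mesh_squares[OF _ disj]] * by simp
qed simp

end
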